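(* Let $\mu=(0,1,\dots,n-1)\in\mathbb Z^n$ and let $\lambda=(\lambda_1,\dots,\lambda_n)$ be a partition with $\lambda_1=m$ and $\lambda_n\ge n$. Then the $m$ polynomials $$\sum_{i\ge1,\ i\le n,\ k+i\le\lambda_i}x_ix_{k+i},\qquad k=0,\dots,m-1,$$ (the diagonals of the tableau $\mathbf T_{\lambda-\mu}$, each summand a monomial generator of $\overline I_{\lambda-\mu}$) generate a minimal reduction $\overline J_{\lambda-\mu}$ of the specialized Ferrers ideal $\overline I_{\lambda-\mu}$.
   Context: Let $K$ be a field. The specialized Ferrers ideal is $\overline I_{\lambda-\mu}=(x_ix_j:1\le i\le n,\ \mu_i<j\le\lambda_i)\subset K[x_1,\dots,x_m]$; for $\mu=(0,1,\dots,n-1)$ this is $(x_ix_j:1\le i\le n,\ i\le j\le\lambda_i)$. An ideal $J\subset I$ is a reduction of $I$ if $I^{r+1}=JI^r$ for some $r\ge0$; it is a minimal reduction if no ideal strictly contained in $J$ is a reduction of $I$. *)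

theory Defs
  imports "HOL-Library.Poly_Mapping"
begin

text \<open>Multivariate polynomials over a field: finitely supported maps from monomials
(finitely supported exponent vectors) to coefficients.  The ring K[x_1,...,x_m] is the
subset of polynomials all of whose monomials only involve the variables 1..m.\<close>

type_synonym 'a mpoly = "(nat \<Rightarrow>\<^sub>0 nat) \<Rightarrow>\<^sub>0 'a"

definition Var :: "nat \<Rightarrow> 'a::comm_ring_1 mpoly" where
  "Var i = Poly_Mapping.single (Poly_Mapping.single i 1) 1"

definition polyring :: "nat \<Rightarrow> 'a::comm_ring_1 mpoly set" where
  "polyring m = {p. \<forall>t \<in> Poly_Mapping.keys p. Poly_Mapping.keys (t::nat \<Rightarrow>\<^sub>0 nat) \<subseteq> {1..m}}"

text \<open>Ideals of a ring R given as a subset (subring) of an ambient commutative ring.\<close>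

definition is_ideal :: "'b::comm_ring_1 set \<Rightarrow> 'b set \<Rightarrow> bool" where
  "is_ideal R J \<longleftrightarrow> J \<subseteq> R \<and> 0 \<in> J \<and> (\<forall>a\<in>J. \<forall>b\<in>J. a + b \<in> J)
      \<and> (\<forall>r\<in>R. \<forall>a\<in>J. r * a \<in> J)"

definition ideal_gen :: "'b::comm_ring_1 set \<Rightarrow> 'b set \<Rightarrow> 'b set" where
  "ideal_gen R G = {\<Sum>g\<in>F. c g * g | F c. finite F \<and> F \<subseteq> G \<and> (\<forall>g\<in>F. c g \<in> R)}"

definition ideal_prod :: "'b::comm_ring_1 set \<Rightarrow> 'b set \<Rightarrow> 'b set \<Rightarrow> 'b set" where
  "ideal_prod R A B = ideal_gen R {a * b | a b. a \<in> A \<and> b \<in> B}"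

fun ideal_pow :: "'b::comm_ring_1 set \<Rightarrow> 'b set \<Rightarrow> nat \<Rightarrow> 'b set" where
  "ideal_pow R I 0 = R"
| "ideal_pow R I (Suc k) = ideal_prod R I (ideal_pow R I k)"

definition is_reduction :: "'b::comm_ring_1 set \<Rightarrow> 'b set \<Rightarrow> 'b set \<Rightarrow> bool" where
  "is_reduction R J I \<longleftrightarrow> is_ideal R J \<and> J \<subseteq> I \<and>
     (\<exists>r. ideal_pow R I (Suc r) = ideal_prod R J (ideal_pow R I r))"

definition is_minimal_reduction :: "'b::comm_ring_1 set \<Rightarrow> 'b set \<Rightarrow> 'b set \<Rightarrow> bool" where
  "is_minimal_reduction R J I \<longleftrightarrow> is_reduction R J I \<and>
     (\<forall>J'. is_ideal R J' \<and> J' \<subset> J \<longrightarrow> \<not> is_reduction R J' I)"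

text \<open>Specialized Ferrers ideal for \<mu> = (0,1,...,n-1): generated by x_i x_j, 1 \<le> i \<le> n,
 i \<le> j \<le> \<lambda>_i (i.e. \<mu>_i = i - 1 < j \<le> \<lambda>_i), inside K[x_1,...,x_m].\<close>
definition ferrers_gens :: "nat \<Rightarrow> (nat \<Rightarrow> nat) \<Rightarrow> 'a::comm_ring_1 mpoly set" where
  "ferrers_gens n lam = {Var i * Var j | i j. 1 \<le> i \<and> i \<le> n \<and> i - 1 < j \<and> j \<le> lam i}"

definition diag_poly :: "nat \<Rightarrow> (nat \<Rightarrow> nat) \<Rightarrow> nat \<Rightarrow> 'a::comm_ring_1 mpoly" where
  "diag_poly n lam k = (\<Sum>i\<in>{i. 1 \<le> i \<and> i \<le> n \<and> k + i \<le> lam i}. Var i * Var (k + i))"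

end

theory Submission
  imports Defs "HOL-Library.Multiset"
begin

text \<open>Reduction: for two monomials \<open>x\<^sub>i x\<^sub>i\<^sub>+\<^sub>k\<close>, \<open>x\<^sub>j x\<^sub>j\<^sub>+\<^sub>k\<close> (\<open>i < j\<close>) on the \<open>k\<close>-th diagonal the product equals
  \<open>(x\<^sub>i x\<^sub>j\<^sub>+\<^sub>k)(x\<^sub>j x\<^sub>i\<^sub>+\<^sub>k)\<close>, whose first factor lies on a higher diagonal and whose second factor is
  again a generator of \<open>I\<close>.  By descending induction on \<open>k\<close>, every generator is nilpotent in the
  fibre ring modulo the diagonal sums.

  Minimality: an ideal \<open>J'\<close> properly inside \<open>J\<close> need not be homogeneous, so one has to argue at every
  prime \<open>P\<close> containing \<open>J' : J\<close> and not only at the origin.  Let \<open>x\<^sub>j\<close> be the first variable outside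
  \<open>P\<close> (if there is none, put \<open>j = m + 1\<close> and \<open>x\<^sub>j = 1\<close>), let \<open>c\<close> be the number of rows with
  \<open>\<lambda>\<^sub>i \<ge> j\<close>, and \<open>D = \<lambda>\<^sub>c\<^sub>+\<^sub>1\<close> (or \<open>D = n\<close> if \<open>c = n\<close>).  Then \<open>J\<close> is generated at \<open>P\<close> by \<open>D\<close> elements
  of \<open>I\<close>: the \<open>x\<^sub>i x\<^sub>j\<close> with \<open>i \<le> c\<close> and the \<open>D - c\<close> diagonals below row \<open>c\<close>.  Exchanging them one by
  one for elements of \<open>J'\<close> must stop early, so modulo \<open>P I\<close> the ideal \<open>J'\<close> has fewer than \<open>D\<close>
  generators at \<open>P\<close>.  If \<open>J'\<close> were a reduction, \<open>I\<^sup>N / P I\<^sup>N\<close> would grow like a polynomial of degree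
  less than \<open>D - 1\<close> in \<open>N\<close>.  But the monomials in the \<open>D\<close> elements \<open>x\<^sub>i x\<^sub>j\<close> (\<open>i \<le> c\<close>) and
  \<open>x\<^sub>c\<^sub>+\<^sub>1 x\<^sub>l\<close> (\<open>c < l \<le> D\<close>) are independent modulo \<open>P I\<^sup>N\<close>.\<close>

subsection \<open>Ideals of a subring\<close>

text \<open>Ideals and reductions are defined relative to a subset of an ambient ring, so the ideal
  theory is developed for any subset closed under 1, differences and products. The instance used
  later is \<open>polyring m\<close>.\<close>

locale subring_set =
  fixes R :: "'b::comm_ring_1 set"
  assumes one_closed [simp, intro]: "1 \<in> R"
    and diff_closed [simp, intro]: "a \<in> R \<Longrightarrow> b \<in> R \<Longrightarrow> a - b \<in> R"
    and mult_closed [simp, intro]: "a \<in> R \<Longrightarrow> b \<in> R \<Longrightarrow> a * b \<in> R"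
begin

lemma zero_closed [simp, intro]: "0 \<in> R"
  using diff_closed[OF one_closed one_closed] by simp

lemma uminus_closed [simp, intro]: "a \<in> R \<Longrightarrow> - a \<in> R"
  using diff_closed[OF zero_closed, of a] by simp

lemma add_closed [simp, intro]: "a \<in> R \<Longrightarrow> b \<in> R \<Longrightarrow> a + b \<in> R"
  using diff_closed[OF _ uminus_closed, of a b] by simp

lemma sum_closed: "(\<And>x. x \<in> A \<Longrightarrow> f x \<in> R) \<Longrightarrow> sum f A \<in> R"
  by (induction A rule: infinite_finite_induct) auto

lemma power_closed [simp, intro]: "a \<in> R \<Longrightarrow> a ^ k \<in> R"
  by (induction k) auto

lemma of_nat_closed [simp, intro]: "of_nat k \<in> R"
  by (induction k) auto

lemma prod_mset_closed: "set_mset X \<subseteq> R \<Longrightarrow> prod_mset X \<in> R"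
  by (induction X) auto

lemma is_idealI:
  assumes "J \<subseteq> R" "0 \<in> J" "\<And>a b. a \<in> J \<Longrightarrow> b \<in> J \<Longrightarrow> a + b \<in> J"
    "\<And>r a. r \<in> R \<Longrightarrow> a \<in> J \<Longrightarrow> r * a \<in> J"
  shows "is_ideal R J"
  using assms by (auto simp: is_ideal_def)

lemma ideal_subset: "is_ideal R J \<Longrightarrow> a \<in> J \<Longrightarrow> a \<in> R"
  by (auto simp: is_ideal_def)

lemma ideal_zero: "is_ideal R J \<Longrightarrow> 0 \<in> J"
  by (auto simp: is_ideal_def)

lemma ideal_add: "is_ideal R J \<Longrightarrow> a \<in> J \<Longrightarrow> b \<in> J \<Longrightarrow> a + b \<in> J"
  by (auto simp: is_ideal_def)

lemma ideal_mult_left: "is_ideal R J \<Longrightarrow> r \<in> R \<Longrightarrow> a \<in> J \<Longrightarrow> r * a \<in> J"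
  by (auto simp: is_ideal_def)

lemma ideal_mult_right: "is_ideal R J \<Longrightarrow> r \<in> R \<Longrightarrow> a \<in> J \<Longrightarrow> a * r \<in> J"
  using ideal_mult_left[of J r a] by (simp add: mult.commute)

lemma ideal_uminus: "is_ideal R J \<Longrightarrow> a \<in> J \<Longrightarrow> - a \<in> J"
  using ideal_mult_left[of J "-1" a] by simp

lemma ideal_diff: "is_ideal R J \<Longrightarrow> a \<in> J \<Longrightarrow> b \<in> J \<Longrightarrow> a - b \<in> J"
  using ideal_add[of J a "- b"] ideal_uminus by simp

lemma ideal_sum: "is_ideal R J \<Longrightarrow> (\<And>x. x \<in> A \<Longrightarrow> f x \<in> J) \<Longrightarrow> sum f A \<in> J"
  by (induction A rule: infinite_finite_induct) (auto intro: ideal_zero ideal_add)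

lemma ideal_R: "is_ideal R R"
  by (auto simp: is_ideal_def)

text \<open>This is the workhorse for passing from generators to ideals: to see that
  \<open>a * b\<close> lies in \<open>K\<close> for all \<open>a\<close> in a generated ideal, it
  suffices by \<open>ideal_gen_least\<close> to test the generators \<open>a\<close>.\<close>

lemma ideal_colon:
  assumes "is_ideal R K" "b \<in> R"
  shows "is_ideal R {a \<in> R. a * b \<in> K}"
  using assms by (intro is_idealI) (simp_all add: subset_eq distrib_right mult.assoc ideal_zero ideal_add ideal_mult_left)

lemma ideal_plus:
  assumes "is_ideal R A" "is_ideal R B"
  shows "is_ideal R {a + b | a b. a \<in> A \<and> b \<in> B}"
proof (rule is_idealI)
  show "{a + b | a b. a \<in> A \<and> b \<in> B} \<subseteq> R"
    using assms ideal_subset by blast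
  show "0 \<in> {a + b | a b. a \<in> A \<and> b \<in> B}"
    using assms ideal_zero by force
next
  fix x y assume "x \<in> {a + b | a b. a \<in> A \<and> b \<in> B}" "y \<in> {a + b | a b. a \<in> A \<and> b \<in> B}"
  then obtain a b a' b' where "x = a + b" "a \<in> A" "b \<in> B" "y = a' + b'" "a' \<in> A" "b' \<in> B"
    by blast
  then have "x + y = (a + a') + (b + b')" "a + a' \<in> A" "b + b' \<in> B"
    using assms ideal_add by (auto simp: algebra_simps)
  then show "x + y \<in> {a + b | a b. a \<in> A \<and> b \<in> B}"
    by blast
next
  fix r x assume r: "r \<in> R" and "x \<in> {a + b | a b. a \<in> A \<and> b \<in> B}"
  then obtain a b where "x = a + b" "a \<in> A" "b \<in> B"
    by blast
  then have "r * x = r * a + r * b" "r * a \<in> A" "r * b \<in> B"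
    using assms r ideal_mult_left by (auto simp: distrib_left)
  then show "r * x \<in> {a + b | a b. a \<in> A \<and> b \<in> B}"
    by blast
qed

lemma ideal_gen_least:
  assumes "is_ideal R J" "G \<subseteq> J"
  shows "ideal_gen R G \<subseteq> J"
  using assms by (auto simp: ideal_gen_def intro!: ideal_sum ideal_mult_left)

lemma ideal_gen_superset: "G \<subseteq> ideal_gen R G"
proof
  fix g assume "g \<in> G"
  then have "g = (\<Sum>x\<in>{g}. 1 * x)" "finite {g}" "{g} \<subseteq> G" "\<forall>x\<in>{g}. 1 \<in> R"
    by auto
  then show "g \<in> ideal_gen R G"
    unfolding ideal_gen_def by (intro CollectI exI[of _ "{g}"] exI[of _ "\<lambda>_. 1"]) auto
qed

lemma ideal_ideal_gen:
  assumes "G \<subseteq> R"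
  shows "is_ideal R (ideal_gen R G)"
proof (rule is_idealI)
  show "ideal_gen R G \<subseteq> R"
    by (rule ideal_gen_least[OF ideal_R assms])
  show "0 \<in> ideal_gen R G"
    unfolding ideal_gen_def by (rule CollectI, rule exI[of _ "{}"]) auto
next
  fix a b assume "a \<in> ideal_gen R G" "b \<in> ideal_gen R G"
  then obtain F c F' c' where a: "a = (\<Sum>g\<in>F. c g * g)" "finite F" "F \<subseteq> G" "\<forall>g\<in>F. c g \<in> R"
    and b: "b = (\<Sum>g\<in>F'. c' g * g)" "finite F'" "F' \<subseteq> G" "\<forall>g\<in>F'. c' g \<in> R"
    unfolding ideal_gen_def by blast
  define d where "d g = (if g \<in> F then c g else 0) + (if g \<in> F' then c' g else 0)" for g
  have "a = (\<Sum>g\<in>F\<union>F'. (if g \<in> F then c g else 0) * g)"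
    unfolding a(1) using a(2) b(2) by (intro sum.mono_neutral_cong_left) auto
  moreover have "b = (\<Sum>g\<in>F\<union>F'. (if g \<in> F' then c' g else 0) * g)"
    unfolding b(1) using a(2) b(2) by (intro sum.mono_neutral_cong_left) auto
  ultimately have "a + b = (\<Sum>g\<in>F\<union>F'. d g * g)"
    by (simp add: d_def distrib_right sum.distrib)
  moreover have "\<forall>g\<in>F\<union>F'. d g \<in> R"
    using a b by (auto simp: d_def)
  ultimately show "a + b \<in> ideal_gen R G"
    unfolding ideal_gen_def using a b by (intro CollectI exI[of _ "F \<union> F'"] exI[of _ d]) auto
next
  fix r a assume r: "r \<in> R" and "a \<in> ideal_gen R G"
  then obtain F c where a: "a = (\<Sum>g\<in>F. c g * g)" "finite F" "F \<subseteq> G" "\<forall>g\<in>F. c g \<in> R"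
    unfolding ideal_gen_def by blast
  then have "r * a = (\<Sum>g\<in>F. (r * c g) * g)"
    by (simp add: sum_distrib_left mult.assoc)
  then show "r * a \<in> ideal_gen R G"
    unfolding ideal_gen_def using a r
    by (intro CollectI exI[of _ F] exI[of _ "\<lambda>g. r * c g"]) auto
qed

lemma ideal_gen_mono: "G \<subseteq> G' \<Longrightarrow> ideal_gen R G \<subseteq> ideal_gen R G'"
proof
  fix x assume G: "G \<subseteq> G'" and "x \<in> ideal_gen R G"
  then obtain F c where "x = (\<Sum>g\<in>F. c g * g)" "finite F" "F \<subseteq> G" "\<forall>g\<in>F. c g \<in> R"
    unfolding ideal_gen_def by blast
  then show "x \<in> ideal_gen R G'"
    unfolding ideal_gen_def using G by (intro CollectI exI[of _ F] exI[of _ c]) auto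
qed

lemma ideal_gen_image_obtain:
  assumes "x \<in> ideal_gen R (f ` A)" "finite A" "f ` A \<subseteq> R"
  obtains c where "\<And>a. a \<in> A \<Longrightarrow> c a \<in> R" "x = (\<Sum>a\<in>A. c a * f a)"
proof -
  define K where "K = {x. \<exists>c. (\<forall>a\<in>A. c a \<in> R) \<and> x = (\<Sum>a\<in>A. c a * f a)}"
  have "is_ideal R K"
  proof (rule is_idealI)
    show "K \<subseteq> R" using assms(3) by (auto simp: K_def intro!: sum_closed)
    show "0 \<in> K" unfolding K_def by (rule CollectI, rule exI[of _ "\<lambda>_. 0"]) simp
  next
    fix a b assume "a \<in> K" "b \<in> K"
    then obtain c c' where "\<forall>a\<in>A. c a \<in> R" "a = (\<Sum>a\<in>A. c a * f a)"
      "\<forall>a\<in>A. c' a \<in> R" "b = (\<Sum>a\<in>A. c' a * f a)" unfolding K_def by blast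
    then show "a + b \<in> K" unfolding K_def
      by (intro CollectI exI[of _ "\<lambda>a. c a + c' a"]) (auto simp: distrib_right sum.distrib)
  next
    fix r a assume "r \<in> R" "a \<in> K"
    then obtain c where "\<forall>a\<in>A. c a \<in> R" "a = (\<Sum>a\<in>A. c a * f a)" unfolding K_def by blast
    then show "r * a \<in> K" unfolding K_def using \<open>r \<in> R\<close>
      by (intro CollectI exI[of _ "\<lambda>a. r * c a"]) (auto simp: sum_distrib_left mult.assoc)
  qed
  moreover have "f ` A \<subseteq> K"
  proof
    fix y assume "y \<in> f ` A"
    then obtain b where b: "b \<in> A" "y = f b" by blast
    have "(\<Sum>a\<in>A. (if a = b then 1 else 0) * f a) = (\<Sum>a\<in>A. if a = b then f a else 0)"
      by (rule sum.cong) auto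
    then have "y = (\<Sum>a\<in>A. (if a = b then 1 else 0) * f a)"
      using b assms(2) by simp
    then show "y \<in> K" unfolding K_def
      by (intro CollectI exI[of _ "\<lambda>a. if a = b then 1 else 0"]) auto
  qed
  ultimately have "x \<in> K" using ideal_gen_least assms(1) by blast
  then show ?thesis using that unfolding K_def by blast
qed

lemma ideal_ideal_prod: "A \<subseteq> R \<Longrightarrow> B \<subseteq> R \<Longrightarrow> is_ideal R (ideal_prod R A B)"
  unfolding ideal_prod_def by (rule ideal_ideal_gen) auto

lemma ideal_prod_memI: "a \<in> A \<Longrightarrow> b \<in> B \<Longrightarrow> a * b \<in> ideal_prod R A B"
  unfolding ideal_prod_def by (rule subsetD[OF ideal_gen_superset]) blast

lemma ideal_prod_least:
  assumes "is_ideal R K" "\<And>a b. a \<in> A \<Longrightarrow> b \<in> B \<Longrightarrow> a * b \<in> K"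
  shows "ideal_prod R A B \<subseteq> K"
  unfolding ideal_prod_def using assms by (intro ideal_gen_least) auto

lemma ideal_prod_mono: "A \<subseteq> A' \<Longrightarrow> B \<subseteq> B' \<Longrightarrow> ideal_prod R A B \<subseteq> ideal_prod R A' B'"
  unfolding ideal_prod_def by (rule ideal_gen_mono) auto

lemma ideal_ideal_pow: "I \<subseteq> R \<Longrightarrow> is_ideal R (ideal_pow R I k)"
proof (induction k)
  case (Suc k)
  then show ?case using ideal_ideal_prod[of I "ideal_pow R I k"] by (simp add: is_ideal_def)
qed (simp add: ideal_R)

lemma ideal_pow_add_mult:
  assumes "is_ideal R I" "a \<in> ideal_pow R I p" "b \<in> ideal_pow R I q"
  shows "a * b \<in> ideal_pow R I (p + q)"
  using assms(2)
proof (induction p arbitrary: a)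
  case 0
  then show ?case using assms ideal_ideal_pow ideal_mult_left
    by (metis add_0 ideal_pow.simps(1) is_ideal_def)
next
  case (Suc p)
  have I: "I \<subseteq> R" using assms(1) by (simp add: is_ideal_def)
  have b: "b \<in> R" using assms(3) I ideal_ideal_pow ideal_subset by blast
  have "ideal_prod R I (ideal_pow R I p) \<subseteq> {a \<in> R. a * b \<in> ideal_pow R I (Suc p + q)}"
  proof (rule ideal_prod_least[OF ideal_colon[OF ideal_ideal_pow[OF I] b]])
    fix x y assume *: "x \<in> I" "y \<in> ideal_pow R I p"
    then have "x * (y * b) \<in> ideal_prod R I (ideal_pow R I (p + q))"
      using Suc.IH by (intro ideal_prod_memI)
    moreover have "y \<in> R" using * I ideal_ideal_pow ideal_subset by blast
    ultimately show "x * y \<in> {a \<in> R. a * b \<in> ideal_pow R I (Suc p + q)}"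
      using * I by (auto simp: mult.assoc)
  qed
  then show ?case using Suc.prems by auto
qed

lemma ideal_pow_1: "is_ideal R I \<Longrightarrow> a \<in> I \<Longrightarrow> a \<in> ideal_pow R I (Suc 0)"
  using ideal_prod_memI[of a I 1 R] by simp

lemma ideal_pow_1_eq: "is_ideal R I \<Longrightarrow> ideal_pow R I (Suc 0) = I"
proof (intro equalityI subsetI)
  assume I: "is_ideal R I"
  fix a show "a \<in> I \<Longrightarrow> a \<in> ideal_pow R I (Suc 0)" by (rule ideal_pow_1[OF I])
  have "ideal_prod R I R \<subseteq> I" using I by (intro ideal_prod_least) (auto intro: ideal_mult_right)
  then show "a \<in> ideal_pow R I (Suc 0) \<Longrightarrow> a \<in> I" by auto
qed

lemma ideal_pow_power:
  assumes "is_ideal R I" "a \<in> ideal_pow R I p"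
  shows "a ^ k \<in> ideal_pow R I (p * k)"
proof (induction k)
  case (Suc k)
  then show ?case using ideal_pow_add_mult[OF assms(1,2) Suc] by simp
qed simp

lemma ideal_pow_prod_mset:
  assumes "is_ideal R I" "set_mset X \<subseteq> I"
  shows "prod_mset X \<in> ideal_pow R I (size X)"
  using assms(2) by (induction X) (auto intro: ideal_prod_memI)

lemma ideal_prod_pow_mult:
  assumes I: "is_ideal R I" and A: "A \<subseteq> R"
    and a: "a \<in> ideal_prod R A (ideal_pow R I p)" and b: "b \<in> ideal_pow R I q"
  shows "a * b \<in> ideal_prod R A (ideal_pow R I (p + q))"
proof -
  have IR: "I \<subseteq> R" using I by (simp add: is_ideal_def)
  have pR: "ideal_pow R I k \<subseteq> R" for k using ideal_ideal_pow[OF IR] by (simp add: is_ideal_def)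
  have bR: "b \<in> R" using b pR by blast
  have "ideal_prod R A (ideal_pow R I p) \<subseteq> {a \<in> R. a * b \<in> ideal_prod R A (ideal_pow R I (p + q))}"
  proof (rule ideal_prod_least[OF ideal_colon[OF ideal_ideal_prod[OF A pR] bR]])
    fix x y assume *: "x \<in> A" "y \<in> ideal_pow R I p"
    then have "x * (y * b) \<in> ideal_prod R A (ideal_pow R I (p + q))"
      using b I by (intro ideal_prod_memI ideal_pow_add_mult)
    then show "x * y \<in> {a \<in> R. a * b \<in> ideal_prod R A (ideal_pow R I (p + q))}"
      using * A pR by (auto simp: mult.assoc)
  qed
  then show ?thesis using a by auto
qed

text \<open>Powers of a finitely generated ideal thereby have explicit finite generating sets. In
  the induction step the colon argument is applied twice, once for each factor of a product.\<close>

lemma ideal_pow_gen: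
  assumes G: "G \<subseteq> R"
  shows "ideal_pow R (ideal_gen R G) k = ideal_gen R (prod_mset ` multisets_of_size G k)"
proof (rule equalityI)
  let ?W = "\<lambda>k. prod_mset ` multisets_of_size G k"
  have W: "?W k \<subseteq> R" for k
    using G by (auto simp: multisets_of_size_def intro!: prod_mset_closed)
  have I: "is_ideal R (ideal_gen R G)" by (rule ideal_ideal_gen[OF G])
  show "ideal_gen R (?W k) \<subseteq> ideal_pow R (ideal_gen R G) k"
  proof (rule ideal_gen_least)
    show "is_ideal R (ideal_pow R (ideal_gen R G) k)"
      using I by (intro ideal_ideal_pow) (simp add: is_ideal_def)
    show "?W k \<subseteq> ideal_pow R (ideal_gen R G) k"
      using ideal_pow_prod_mset[OF I] ideal_gen_superset[of G] by (auto simp: multisets_of_size_def)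
  qed
  show "ideal_pow R (ideal_gen R G) k \<subseteq> ideal_gen R (?W k)"
  proof (induction k)
    case 0
    have "r * 1 \<in> ideal_gen R (?W 0)" if "r \<in> R" for r
      using that ideal_gen_superset[of "?W 0"] ideal_ideal_gen[OF W[of 0]]
      by (intro ideal_mult_left) auto
    then show ?case by auto
  next
    case (Suc k)
    have K: "is_ideal R (ideal_gen R (?W (Suc k)))" by (rule ideal_ideal_gen[OF W])
    have "ideal_prod R (ideal_gen R G) (ideal_pow R (ideal_gen R G) k) \<subseteq> ideal_gen R (?W (Suc k))"
    proof (rule ideal_prod_least[OF K])
      fix a b assume a: "a \<in> ideal_gen R G" and b: "b \<in> ideal_pow R (ideal_gen R G) k"
      have "g * b \<in> ideal_gen R (?W (Suc k))" if g: "g \<in> G" for g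
      proof -
        have gR: "g \<in> R" using g G by auto
        have "ideal_gen R (?W k) \<subseteq> {b \<in> R. b * g \<in> ideal_gen R (?W (Suc k))}"
        proof (rule ideal_gen_least[OF ideal_colon[OF K gR]], safe)
          fix X assume X: "X \<in> multisets_of_size G k"
          then show "prod_mset X \<in> R" using W by blast
          have "add_mset g X \<in> multisets_of_size G (Suc k)"
            using X g by (auto simp: multisets_of_size_def)
          then have "prod_mset (add_mset g X) \<in> ideal_gen R (?W (Suc k))"
            using ideal_gen_superset by blast
          then show "prod_mset X * g \<in> ideal_gen R (?W (Suc k))"
            by (simp add: mult.commute)
        qed
        then show ?thesis using b Suc.IH by (auto simp: mult.commute)
      qed
      moreover have bR: "b \<in> R" using b Suc.IH W ideal_gen_least[OF ideal_R W] by blast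
      ultimately have "ideal_gen R G \<subseteq> {a \<in> R. a * b \<in> ideal_gen R (?W (Suc k))}"
        using G by (intro ideal_gen_least[OF ideal_colon[OF K bR]]) auto
      then show "a * b \<in> ideal_gen R (?W (Suc k))" using a by auto
    qed
    then show ?case by simp
  qed
qed

end

subsection \<open>Reductions and primes\<close>

text \<open>The right side counts multisets of size \<open>N + r\<close> in \<open>D\<close>
  elements and grows like a polynomial of degree \<open>D - 1\<close> in \<open>N\<close>; the left
  side has degree less than \<open>D - 1\<close>, or vanishes for \<open>N > 0\<close> if
  \<open>q = 0\<close>.\<close>

lemma binomial_growth:
  fixes C r q D :: nat
  assumes "q < D"
  shows "\<exists>N. C * ((q + N - 1) choose N) < (D + (N + r) - 1) choose (N + r)"
proof -
  obtain d where d: "D = Suc d" using assms by (cases D) auto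
  \<comment> \<open>For \<open>d > 0\<close> the quotient of \<open>(d + N) choose N\<close> by
    \<open>(d + N - 1) choose N\<close> is \<open>(d + N) / d\<close>, which exceeds
    \<open>C\<close> as soon as \<open>N > C * d\<close>. For \<open>d = 0\<close> the smaller
    binomial vanishes because \<open>N > 0\<close>.\<close>
  have "C * ((q + N - 1) choose N) < (D + (N + r) - 1) choose (N + r)" if N: "N = Suc (C * d)" for N
  proof -
    have qd: "q \<le> d" using assms d by simp
    have "(q + N - 1) choose N \<le> (d + N - 1) choose N"
      using qd by (intro binomial_right_mono) auto
    then have 1: "C * ((q + N - 1) choose N) \<le> C * ((d + N - 1) choose N)" by simp
    have "(d + N) choose N = (d + N) choose d" using binomial_symmetric[of N "d + N"] by simp
    also have "\<dots> \<le> (d + (N + r)) choose d" by (intro binomial_right_mono) auto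
    also have "\<dots> = (d + (N + r)) choose (N + r)"
      using binomial_symmetric[of "N + r" "d + (N + r)"] by simp
    finally have 2: "(d + N) choose N \<le> (D + (N + r) - 1) choose (N + r)" by (simp add: d)
    have 3: "C * ((d + N - 1) choose N) < (d + N) choose N"
    proof (cases d)
      case 0
      then show ?thesis using N by simp
    next
      case (Suc e)
      have a: "(d + N - 1) choose N = (e + N) choose e" using Suc binomial_symmetric[of N "e + N"] by simp
      have b: "(d + N) choose N = (Suc (e + N)) choose (Suc e)"
        using Suc binomial_symmetric[of N "d + N"] by simp
      have c: "Suc e * (Suc (e + N) choose Suc e) = Suc (e + N) * ((e + N) choose e)"
        by (rule Suc_times_binomial)
      have p: "0 < (e + N) choose e" by simp
      have "C * Suc e < Suc (e + N)" using N Suc by (simp add: mult.commute)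
      then have "C * Suc e * ((e + N) choose e) < Suc (e + N) * ((e + N) choose e)"
        using p by (simp only: mult_less_cancel2)
      then have "Suc e * (C * ((e + N) choose e)) < Suc e * (Suc (e + N) choose Suc e)"
        unfolding c by (simp only: mult_ac)
      then show ?thesis unfolding a b by (simp only: mult_less_cancel1)
    qed
    show ?thesis using 1 2 3 by linarith
  qed
  then show ?thesis by blast
qed

lemma multiset_pigeonhole:
  assumes "finite G" "set_mset X \<subseteq> G" "size X > card G * N"
  shows "\<exists>g\<in>G. count X g \<ge> N"
proof (rule ccontr)
  assume "\<not> ?thesis"
  then have "count X g \<le> N" if "g \<in> G" for g using that by force
  then have "(\<Sum>g\<in>set_mset X. count X g) \<le> (\<Sum>g\<in>set_mset X. N)"
    using assms(2) by (intro sum_mono) auto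
  also have "\<dots> \<le> card G * N" using card_mono[OF assms(1,2)] by simp
  finally show False using assms(3) by (simp add: size_multiset_overloaded_eq)
qed

section \<open>Nilpotence in the fibre ring and a criterion for reductions\<close>

context subring_set
begin

text \<open>\<open>a\<close>, placed in degree \<open>d\<close> of the Rees algebra of \<open>I\<close>, is nilpotent modulo the ideal generated by
  \<open>J\<close> in degree 1.  The truncated \<open>d * N - 1\<close> is only meaningful for \<open>d > 0\<close>.\<close>

definition nilpotent_mod :: "'b set \<Rightarrow> 'b set \<Rightarrow> nat \<Rightarrow> 'b \<Rightarrow> bool" where
  "nilpotent_mod J I d a \<longleftrightarrow> a \<in> ideal_pow R I d \<and>
     (\<exists>N>0. a ^ N \<in> ideal_prod R J (ideal_pow R I (d * N - 1)))"

context
  fixes I J assumes I: "is_ideal R I" and J: "is_ideal R J"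
begin

lemma pow_subset: "ideal_pow R I k \<subseteq> R" and ideal_pow_I: "is_ideal R (ideal_pow R I k)"
proof -
  show "is_ideal R (ideal_pow R I k)" using I by (intro ideal_ideal_pow) (simp add: is_ideal_def)
  then show "ideal_pow R I k \<subseteq> R" by (simp add: is_ideal_def)
qed

lemma ideal_J_pow: "is_ideal R (ideal_prod R J (ideal_pow R I k))"
  using J pow_subset by (intro ideal_ideal_prod) (auto simp: is_ideal_def)

lemma J_pow_mult:
  assumes "a \<in> ideal_prod R J (ideal_pow R I (p - 1))" "b \<in> ideal_pow R I q" "p > 0"
  shows "a * b \<in> ideal_prod R J (ideal_pow R I (p + q - 1))"
  using ideal_prod_pow_mult[OF I _ assms(1,2)] J assms(3) by (simp add: is_ideal_def)

lemma nilpotent_mod_of_J: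
  "a \<in> ideal_pow R I d \<Longrightarrow> a \<in> ideal_prod R J (ideal_pow R I (d - 1)) \<Longrightarrow> nilpotent_mod J I d a"
  unfolding nilpotent_mod_def by (intro conjI exI[of _ 1]) auto

lemma nilpotent_mod_mult:
  assumes "nilpotent_mod J I d a" "b \<in> ideal_pow R I e" "d > 0"
  shows "nilpotent_mod J I (d + e) (a * b)"
proof -
  obtain N where N: "N > 0" "a ^ N \<in> ideal_prod R J (ideal_pow R I (d * N - 1))"
    and a: "a \<in> ideal_pow R I d" using assms unfolding nilpotent_mod_def by blast
  have "a ^ N * b ^ N \<in> ideal_prod R J (ideal_pow R I (d * N + e * N - 1))"
    using N assms by (intro J_pow_mult ideal_pow_power[OF I]) auto
  then show ?thesis unfolding nilpotent_mod_def using N a assms ideal_pow_add_mult[OF I]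
    by (intro conjI exI[of _ N]) (auto simp: power_mult_distrib distrib_right)
qed

lemma nilpotent_mod_uminus: "nilpotent_mod J I d a \<Longrightarrow> nilpotent_mod J I d (- a)"
proof -
  assume "nilpotent_mod J I d a"
  then obtain N where N: "N > 0" "a ^ N \<in> ideal_prod R J (ideal_pow R I (d * N - 1))"
    and a: "a \<in> ideal_pow R I d" unfolding nilpotent_mod_def by blast
  have "(- a) ^ N = (- 1) ^ N * a ^ N" by (rule power_minus)
  then have "(- a) ^ N \<in> ideal_prod R J (ideal_pow R I (d * N - 1))"
    using N ideal_mult_left[OF ideal_J_pow] by auto
  then show ?thesis unfolding nilpotent_mod_def using a N ideal_uminus[OF ideal_pow_I] by blast
qed

text \<open>Each term of the binomial expansion of \<open>(a + b) ^ (N + M)\<close> contains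
  \<open>a ^ N\<close> or \<open>b ^ M\<close>. Both elements sit in the same degree
  \<open>d\<close>, so all terms land in degree \<open>d * (N + M)\<close>.\<close>

lemma nilpotent_mod_add:
  assumes "nilpotent_mod J I d a" "nilpotent_mod J I d b" "d > 0"
  shows "nilpotent_mod J I d (a + b)"
proof -
  obtain N where N: "N > 0" "a ^ N \<in> ideal_prod R J (ideal_pow R I (d * N - 1))"
    and a: "a \<in> ideal_pow R I d" using assms unfolding nilpotent_mod_def by blast
  obtain M where M: "M > 0" "b ^ M \<in> ideal_prod R J (ideal_pow R I (d * M - 1))"
    and b: "b \<in> ideal_pow R I d" using assms unfolding nilpotent_mod_def by blast
  have term_mem: "of_nat (N + M choose k) * a ^ k * b ^ (N + M - k) \<in>
     ideal_prod R J (ideal_pow R I (d * (N + M) - 1))" if k: "k \<le> N + M" for k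
  proof (cases "N \<le> k")
    case True
    have e: "a ^ k * b ^ (N + M - k) = a ^ N * (a ^ (k - N) * b ^ (N + M - k))"
      using True by (simp add: mult.assoc[symmetric] power_add[symmetric])
    have "d * N + (d * (k - N) + d * (N + M - k)) = d * (N + M)"
      using True k by (simp flip: distrib_left)
    moreover have "a ^ N * (a ^ (k - N) * b ^ (N + M - k)) \<in>
        ideal_prod R J (ideal_pow R I (d * N + (d * (k - N) + d * (N + M - k)) - 1))"
      using N assms(3) a b by (intro J_pow_mult ideal_pow_add_mult[OF I] ideal_pow_power[OF I]) auto
    ultimately show ?thesis using ideal_mult_left[OF ideal_J_pow of_nat_closed] e
      by (metis mult.assoc)
  next
    case False
    then obtain l where l: "N + M - k = M + l" "l + k = N"
      using k that by (metis add.commute add_diff_assoc le_add_diff_inverse nat_le_linear add_diff_cancel_left' diff_add_assoc2)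
    have e: "a ^ k * b ^ (N + M - k) = b ^ M * (b ^ l * a ^ k)"
      unfolding l(1) by (simp add: power_add mult_ac)
    have "d * M + (d * l + d * k) = d * (N + M)"
      using l by (simp flip: distrib_left)
    moreover have "b ^ M * (b ^ l * a ^ k) \<in> ideal_prod R J (ideal_pow R I (d * M + (d * l + d * k) - 1))"
      using M assms(3) a b by (intro J_pow_mult ideal_pow_add_mult[OF I] ideal_pow_power[OF I]) auto
    ultimately show ?thesis using ideal_mult_left[OF ideal_J_pow of_nat_closed] e
      by (metis mult.assoc)
  qed
  have "(a + b) ^ (N + M) \<in> ideal_prod R J (ideal_pow R I (d * (N + M) - 1))"
    unfolding binomial_ring using term_mem by (intro ideal_sum[OF ideal_J_pow]) auto
  then show ?thesis unfolding nilpotent_mod_def using a b N ideal_add[OF ideal_pow_I]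
    by (intro conjI exI[of _ "N + M"]) auto
qed

lemma nilpotent_mod_sum:
  assumes "d > 0" "\<And>x. x \<in> A \<Longrightarrow> nilpotent_mod J I d (f x)"
  shows "nilpotent_mod J I d (sum f A)"
  using assms(2)
proof (induction A rule: infinite_finite_induct)
  case (insert x A)
  then show ?case using nilpotent_mod_add[OF _ _ assms(1)] by simp
qed (auto intro!: nilpotent_mod_of_J ideal_zero ideal_pow_I ideal_J_pow)

lemma nilpotent_mod_square:
  assumes "a \<in> ideal_pow R I d" "nilpotent_mod J I (2 * d) (a * a)"
  shows "nilpotent_mod J I d a"
proof -
  obtain N where N: "N > 0" "(a * a) ^ N \<in> ideal_prod R J (ideal_pow R I (2 * d * N - 1))"
    using assms unfolding nilpotent_mod_def by blast
  have "(a * a) ^ N = a ^ (2 * N)" by (simp add: power_mult power2_eq_square)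
  then show ?thesis unfolding nilpotent_mod_def using assms(1) N
    by (intro conjI exI[of _ "2 * N"]) (auto simp: mult_ac)
qed

end

text \<open>A product of sufficiently many generators contains a high power of one of them, hence a
  factor in \<open>J\<close> times a power of \<open>I\<close>; such products generate
  \<open>ideal_pow R I (Suc r)\<close>.\<close>

lemma reduction_if_nilpotent_mod:
  assumes G: "finite G" "G \<subseteq> R" and J: "is_ideal R J" "J \<subseteq> ideal_gen R G"
    and nil: "\<And>g. g \<in> G \<Longrightarrow> nilpotent_mod J (ideal_gen R G) 1 g"
  shows "is_reduction R J (ideal_gen R G)"
proof -
  define I where "I = ideal_gen R G"
  have I: "is_ideal R I" unfolding I_def by (rule ideal_ideal_gen[OF G(2)])
  have GI: "G \<subseteq> I" unfolding I_def by (rule ideal_gen_superset)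
  have "\<forall>g\<in>G. \<exists>N>0. g ^ N \<in> ideal_prod R J (ideal_pow R I (N - 1))"
    using nil unfolding nilpotent_mod_def I_def by auto
  then obtain f where f: "\<And>g. g \<in> G \<Longrightarrow> f g > 0 \<and> g ^ f g \<in> ideal_prod R J (ideal_pow R I (f g - 1))"
    by metis
  \<comment> \<open>The sum is a common upper bound for all exponents \<open>f g\<close>. Among
    \<open>card G * N + 1\<close> factors some generator occurs at least \<open>N\<close>
    times.\<close>
  define N where "N = (\<Sum>g\<in>G. f g)"
  define r where "r = card G * N"
  have prod_mem: "prod_mset X \<in> ideal_prod R J (ideal_pow R I r)" if X: "X \<in> multisets_of_size G (Suc r)" for X
  proof -
    have sX: "set_mset X \<subseteq> G" "size X = Suc r" using X by (auto simp: multisets_of_size_def)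
    obtain g where g: "g \<in> G" "count X g \<ge> N"
      using multiset_pigeonhole[OF G(1) sX(1), of N] sX(2) r_def by auto
    have "f g \<le> N" unfolding N_def using g(1) G(1) by (intro member_le_sum) auto
    then have sub: "replicate_mset (f g) g \<subseteq># X" using g(2) count_le_replicate_mset_subset_eq
      by (metis order_trans)
    define Y where "Y = X - replicate_mset (f g) g"
    have XY: "X = replicate_mset (f g) g + Y" using sub by (simp add: Y_def)
    have "set_mset Y \<subseteq> I" using sX(1) GI XY by auto
    then have "prod_mset Y \<in> ideal_pow R I (size Y)" by (rule ideal_pow_prod_mset[OF I])
    then have "g ^ f g * prod_mset Y \<in> ideal_prod R J (ideal_pow R I (f g + size Y - 1))"
      using f[OF g(1)] by (intro J_pow_mult[OF I J(1)]) auto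
    moreover have "f g + size Y = Suc r" using sX(2) XY by (metis size_union size_replicate_mset)
    ultimately show ?thesis by (subst XY) simp
  qed
  have "ideal_pow R I (Suc r) \<subseteq> ideal_prod R J (ideal_pow R I r)"
    unfolding I_def ideal_pow_gen[OF G(2)]
    by (rule ideal_gen_least) (use ideal_J_pow[OF I J(1)] prod_mem in \<open>auto simp: I_def ideal_pow_gen[OF G(2)]\<close>)
  moreover have "ideal_prod R J (ideal_pow R I r) \<subseteq> ideal_pow R I (Suc r)"
    using J(2) unfolding ideal_pow.simps I_def by (rule ideal_prod_mono) simp
  ultimately show ?thesis unfolding is_reduction_def using J I_def by blast
qed

section \<open>Prime ideals and linear algebra modulo a prime\<close>

definition prime_in :: "'b set \<Rightarrow> bool" where
  "prime_in P \<longleftrightarrow> is_ideal R P \<and> 1 \<notin> P \<and> (\<forall>a\<in>R. \<forall>b\<in>R. a * b \<in> P \<longrightarrow> a \<in> P \<or> b \<in> P)"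

lemma prime_in_power: "prime_in P \<Longrightarrow> a \<in> R \<Longrightarrow> a ^ k \<in> P \<Longrightarrow> a \<in> P"
  by (induction k) (auto simp: prime_in_def)

text \<open>Zorn's lemma yields an ideal \<open>P\<close> maximal among those that contain
  \<open>A\<close> and avoid 1. It is prime, since any \<open>x\<close> outside \<open>P\<close>
  generates the unit ideal together with \<open>P\<close>.\<close>

lemma exists_prime_in:
  assumes "is_ideal R A" "1 \<notin> A"
  shows "\<exists>P. prime_in P \<and> A \<subseteq> P"
proof -
  define AA where "AA = {K. is_ideal R K \<and> A \<subseteq> K \<and> 1 \<notin> K}"
  have "\<exists>M\<in>AA. \<forall>X\<in>AA. M \<subseteq> X \<longrightarrow> X = M"
  proof (rule subset_Zorn_nonempty)
    show "AA \<noteq> {}" using assms by (auto simp: AA_def)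
    fix C assume C: "C \<noteq> {}" "subset.chain AA C"
    have id: "is_ideal R K" "A \<subseteq> K" "1 \<notin> K" if "K \<in> C" for K
      using C that unfolding subset.chain_def AA_def by auto
    have lin: "K \<subseteq> K' \<or> K' \<subseteq> K" if "K \<in> C" "K' \<in> C" for K K'
      using C that unfolding subset.chain_def by blast
    have "is_ideal R (\<Union>C)"
    proof (rule is_idealI)
      show "\<Union>C \<subseteq> R" using id ideal_subset by blast
      show "0 \<in> \<Union>C" using C(1) id ideal_zero by blast
      fix a b assume "a \<in> \<Union>C" "b \<in> \<Union>C"
      then obtain K K' where K: "a \<in> K" "b \<in> K'" "K \<in> C" "K' \<in> C" by blast
      from lin[OF K(3,4)] show "a + b \<in> \<Union>C"
      proof
        assume "K \<subseteq> K'"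
        then have "a + b \<in> K'" using K id by (intro ideal_add) auto
        then show ?thesis using K by blast
      next
        assume "K' \<subseteq> K"
        then have "a + b \<in> K" using K id by (intro ideal_add) auto
        then show ?thesis using K by blast
      qed
    next
      fix r a assume "r \<in> R" "a \<in> \<Union>C"
      then show "r * a \<in> \<Union>C" using id ideal_mult_left by blast
    qed
    moreover have "A \<subseteq> \<Union>C" "1 \<notin> \<Union>C" using C(1) id by blast+
    ultimately show "\<Union>C \<in> AA" by (simp add: AA_def)
  qed
  then obtain P where PAA: "P \<in> AA" "\<forall>X\<in>AA. P \<subseteq> X \<longrightarrow> X = P" by blast
  then have P: "is_ideal R P" "A \<subseteq> P" "1 \<notin> P" by (simp_all add: AA_def)
  have max: "X = P" if "is_ideal R X" "A \<subseteq> X" "1 \<notin> X" "P \<subseteq> X" for X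
    using PAA(2) that by (simp add: AA_def)
  have split_one: "\<exists>p\<in>P. \<exists>r\<in>R. 1 = p + r * x" if x: "x \<in> R" "x \<notin> P" for x
  proof (rule ccontr)
    assume no: "\<not> ?thesis"
    define X where "X = {p + q | p q. p \<in> P \<and> q \<in> ideal_gen R {x}}"
    have gx: "is_ideal R (ideal_gen R {x})" using x by (intro ideal_ideal_gen) auto
    have X: "is_ideal R X" unfolding X_def by (rule ideal_plus[OF P(1) gx])
    have PX: "P \<subseteq> X"
    proof
      fix p assume "p \<in> P"
      then show "p \<in> X" unfolding X_def using ideal_zero[OF gx] by (intro CollectI exI[of _ p] exI[of _ 0]) auto
    qed
    have "x \<in> ideal_gen R {x}" using ideal_gen_superset by blast
    then have xX: "x \<in> X" unfolding X_def using ideal_zero[OF P(1)]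
      by (intro CollectI exI[of _ 0] exI[of _ x]) auto
    have "1 \<notin> X"
    proof
      assume "1 \<in> X"
      then obtain p q where pq: "1 = p + q" "p \<in> P" "q \<in> ideal_gen R ((\<lambda>x. x) ` {x})" unfolding X_def by auto
      then obtain c where "c x \<in> R" "q = (\<Sum>a\<in>{x}. c a * a)"
        using x by (elim ideal_gen_image_obtain) auto
      then show False using no pq by auto
    qed
    then have "X = P" using max X PX P(2) by blast
    then show False using xX x by blast
  qed
  have "a \<in> P \<or> b \<in> P" if ab: "a \<in> R" "b \<in> R" "a * b \<in> P" for a b
  proof (rule ccontr)
    assume "\<not> ?thesis"
    then obtain p r q s where *: "p \<in> P" "r \<in> R" "1 = p + r * a" "q \<in> P" "s \<in> R" "1 = q + s * b"
      using split_one ab by metis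
    then have "1 = (p + r * a) * (q + s * b)" by simp
    also have "\<dots> = (q + s * b) * p + ((r * a) * q + (r * s) * (a * b))" by (simp add: algebra_simps)
    also have "\<dots> \<in> P"
    proof (intro ideal_add[OF P(1)])
      show "(q + s * b) * p \<in> P" using * ab ideal_subset[OF P(1)] by (intro ideal_mult_left[OF P(1)]) auto
      show "(r * a) * q \<in> P" using * ab by (intro ideal_mult_left[OF P(1)]) auto
      show "(r * s) * (a * b) \<in> P" using * ab(3) by (rule_tac ideal_mult_left[OF P(1)]) auto
    qed
    finally show False using P(3) by simp
  qed
  then show ?thesis using P unfolding prime_in_def by blast
qed

text \<open>A homogeneous linear system with more unknowns than equations has a nontrivial solution
  over the residue field at \<open>P\<close>. Gaussian elimination without division keeps the
  solution inside \<open>R\<close>.\<close>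

lemma linear_system_mod_prime:
  assumes P: "prime_in P" and "finite G"
    and "finite E" "card G < card E" "\<And>e g. e \<in> E \<Longrightarrow> g \<in> G \<Longrightarrow> b e g \<in> R"
  shows "\<exists>y. (\<forall>e\<in>E. y e \<in> R) \<and> (\<exists>e\<in>E. y e \<notin> P) \<and> (\<forall>g\<in>G. (\<Sum>e\<in>E. y e * b e g) \<in> P)"
  using assms(2-)
proof (induction G arbitrary: E b rule: finite_induct)
  case empty
  then obtain e where "e \<in> E" by fastforce
  then show ?case using P by (intro exI[of _ "\<lambda>_. 1"]) (auto simp: prime_in_def)
next
  case (insert h G)
  have Pi: "is_ideal R P" using P by (simp add: prime_in_def)
  show ?case
  proof (cases "\<forall>e\<in>E. b e h \<in> P")
    case True
    obtain y where y: "\<forall>e\<in>E. y e \<in> R" "\<exists>e\<in>E. y e \<notin> P" "\<forall>g\<in>G. (\<Sum>e\<in>E. y e * b e g) \<in> P"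
      using insert.IH[of E b] insert.prems insert.hyps by auto
    have "(\<Sum>e\<in>E. y e * b e h) \<in> P" using True y(1) by (intro ideal_sum[OF Pi] ideal_mult_left[OF Pi]) auto
    then show ?thesis using y by (intro exI[of _ y]) auto
  next
    case False
    then obtain k where k: "k \<in> E" "b k h \<notin> P" by blast
    define E' where "E' = E - {k}"
    \<comment> \<open>Elimination of the unknown \<open>k\<close> with pivot \<open>b k h\<close>,
      cleared of denominators; the row of \<open>h\<close> becomes zero.\<close>
    define b' where "b' e g = b k h * b e g - b e h * b k g" for e g
    have E: "E = insert k E'" "k \<notin> E'" "finite E'" using k insert.prems by (auto simp: E'_def)
    have "card G < card E'" using insert.prems insert.hyps k by (simp add: E'_def)
    then obtain z where z: "\<forall>e\<in>E'. z e \<in> R" "\<exists>e\<in>E'. z e \<notin> P" "\<forall>g\<in>G. (\<Sum>e\<in>E'. z e * b' e g) \<in> P"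
      using insert.IH[of E' b'] insert.prems E by (auto simp: b'_def)
    \<comment> \<open>Back substitution: the other unknowns are scaled by the pivot, which is
      harmless because the pivot lies outside the prime \<open>P\<close>, and \<open>y k\<close> is
      chosen so that equation \<open>h\<close> holds exactly.\<close>
    define y where "y e = (if e = k then - (\<Sum>e\<in>E'. z e * b e h) else b k h * z e)" for e
    have sum_y: "(\<Sum>e\<in>E. y e * b e g) = (\<Sum>e\<in>E'. z e * b' e g)" for g
    proof -
      have "(\<Sum>e\<in>E. y e * b e g) = y k * b k g + (\<Sum>e\<in>E'. y e * b e g)"
        using E by simp
      also have "(\<Sum>e\<in>E'. y e * b e g) = (\<Sum>e\<in>E'. b k h * z e * b e g)"
        using E by (intro sum.cong) (auto simp: y_def)
      finally show ?thesis
        by (simp add: y_def b'_def sum_distrib_left sum_distrib_right sum_subtractf algebra_simps)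
    qed
    have "y e \<in> R" if "e \<in> E" for e
      using that E z(1) insert.prems k unfolding y_def by (auto intro!: sum_closed)
    moreover have "\<exists>e\<in>E. y e \<notin> P"
    proof -
      obtain e where e: "e \<in> E'" "z e \<notin> P" using z by blast
      then have "b k h * z e \<notin> P" using P k z(1) insert.prems unfolding prime_in_def by blast
      then show ?thesis using e E by (intro bexI[of _ e]) (auto simp: y_def)
    qed
    moreover have "(\<Sum>e\<in>E. y e * b e g) \<in> P" if "g \<in> insert h G" for g
    proof (cases "g = h")
      case True
      have "(\<Sum>e\<in>E'. z e * b' e h) = 0" by (simp add: b'_def mult.commute)
      then show ?thesis using True sum_y ideal_zero[OF Pi] by simp
    next
      case False
      then show ?thesis using that z(3) sum_y by simp
    qed
    ultimately show ?thesis by blast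
  qed
qed

text \<open>If some element of \<open>J'\<close> involves a generator \<open>g \<in> G\<close> with coefficient outside \<open>P\<close>, it can replace
  \<open>g\<close> at \<open>P\<close>.  If this never got stuck, \<open>J\<close> and \<open>J'\<close> would agree at \<open>P\<close>.\<close>

lemma exchange_generators:
  assumes P: "prime_in P" and J: "is_ideal R J'" "J \<subseteq> R" "J' \<subseteq> J"
    and no: "\<And>u. u \<in> R \<Longrightarrow> u \<notin> P \<Longrightarrow> \<exists>h\<in>J. u * h \<notin> J'"
    and G: "finite G" "G \<subseteq> I" "I \<subseteq> R" and H: "finite H" "H \<subseteq> J'" and y: "y \<in> R" "y \<notin> P"
    and gen: "\<And>h. h \<in> J \<Longrightarrow> \<exists>s\<in>ideal_gen R H. \<exists>c. (\<forall>g\<in>G. c g \<in> R) \<and> y * h = s + (\<Sum>g\<in>G. c g * g)"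
  shows "\<exists>u X. u \<in> R \<and> u \<notin> P \<and> finite X \<and> X \<subseteq> J' \<and> card X < card H + card G \<and>
    (\<forall>h\<in>J'. \<exists>s\<in>ideal_gen R X. \<exists>p\<in>ideal_prod R P I. u * h = s + p)"
  using G(1,2) H y gen
proof (induction "card G" arbitrary: G H y)
  case 0
  \<comment> \<open>With no generator left in \<open>G\<close>, multiplication by \<open>y\<close>
    would carry \<open>J\<close> into \<open>J'\<close>, contrary to \<open>no\<close>.\<close>
  have "y * h \<in> J'" if "h \<in> J" for h
  proof -
    have "y * h \<in> ideal_gen R H" using 0(1,2) 0(8)[OF that] by auto
    then show ?thesis using ideal_gen_least[OF J(1) 0(5)] by blast
  qed
  then show ?case using no[OF 0(6,7)] by blast
next
  case (Suc f)
  note gen = Suc.prems(7)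
  have Pi: "is_ideal R P" using P by (simp add: prime_in_def)
  have HR: "H \<subseteq> R" using Suc.prems J by blast
  have iH: "is_ideal R (ideal_gen R H)" by (rule ideal_ideal_gen[OF HR])
  show ?case
  proof (cases "\<exists>h0\<in>J'. \<exists>s0\<in>ideal_gen R H. \<exists>c0. (\<forall>g\<in>G. c0 g \<in> R) \<and>
      y * h0 = s0 + (\<Sum>g\<in>G. c0 g * g) \<and> (\<exists>g\<in>G. c0 g \<notin> P)")
    \<comment> \<open>The exchange is stuck: every element of \<open>J'\<close> has all its
      \<open>G\<close>-coefficients in \<open>P\<close>, so \<open>X = H\<close> works. The strict
      bound on the cardinality holds because \<open>G\<close> is not empty.\<close>
    case False
    have "\<exists>s\<in>ideal_gen R H. \<exists>p\<in>ideal_prod R P I. y * h = s + p" if h: "h \<in> J'" for h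
    proof -
      obtain s c where s: "s \<in> ideal_gen R H" "\<forall>g\<in>G. c g \<in> R" "y * h = s + (\<Sum>g\<in>G. c g * g)"
        using gen[OF subsetD[OF J(3) h]] by blast
      then have "\<forall>g\<in>G. c g \<in> P" using False h by blast
      moreover have "is_ideal R (ideal_prod R P I)"
        using Pi assms(8) by (intro ideal_ideal_prod) (auto simp: is_ideal_def)
      ultimately have "(\<Sum>g\<in>G. c g * g) \<in> ideal_prod R P I"
        using Suc.prems(2) by (intro ideal_sum ideal_prod_memI) auto
      then show ?thesis using s by blast
    qed
    moreover have "card H < card H + card G" using Suc.hyps(2) by simp
    ultimately show ?thesis using Suc.prems by blast
  next
    case True
    then obtain h0 s0 c0 k where h0: "h0 \<in> J'" "s0 \<in> ideal_gen R H" "\<forall>g\<in>G. c0 g \<in> R"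
      "y * h0 = s0 + (\<Sum>g\<in>G. c0 g * g)" "k \<in> G" "c0 k \<notin> P" by blast
    define G' where "G' = G - {k}"
    have G': "G = insert k G'" "k \<notin> G'" "finite G'" using h0 Suc.prems(1) by (auto simp: G'_def)
    have f: "f = card G'" using Suc.hyps(2) G' by simp
    define H' where "H' = insert h0 H"
    have H': "finite H'" "H' \<subseteq> J'" using Suc.prems h0 by (auto simp: H'_def)
    have iH': "is_ideal R (ideal_gen R H')" using H' J by (intro ideal_ideal_gen) blast
    have HH: "ideal_gen R H \<subseteq> ideal_gen R H'" unfolding H'_def by (rule ideal_gen_mono) blast
    have h0H: "h0 \<in> ideal_gen R H'" using ideal_gen_superset[of H'] by (auto simp: H'_def)
    have yc: "c0 k * y \<in> R" "c0 k * y \<notin> P" using P h0 Suc.prems unfolding prime_in_def by blast+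
    have gen': "\<exists>s\<in>ideal_gen R H'. \<exists>c. (\<forall>g\<in>G'. c g \<in> R) \<and> c0 k * y * h = s + (\<Sum>g\<in>G'. c g * g)"
      if hJ: "h \<in> J" for h
    proof -
      obtain s c where s: "s \<in> ideal_gen R H" "\<forall>g\<in>G. c g \<in> R" "y * h = s + (\<Sum>g\<in>G. c g * g)"
        using gen[OF hJ] by blast
      \<comment> \<open>The relation for \<open>h\<close> is multiplied by \<open>c0 k\<close>, and
        \<open>c0 k * k\<close> is then replaced by means of the relation for
        \<open>h0\<close>.\<close>
      define s' where "s' = c0 k * s + (c k * y * h0 - c k * s0)"
      have "s' \<in> ideal_gen R H'" unfolding s'_def using HH h0 s h0H Suc.prems
        by (intro ideal_add[OF iH'] ideal_diff[OF iH'] ideal_mult_left[OF iH']) auto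
      moreover have "c0 k * y * h = s' + (\<Sum>g\<in>G'. (c0 k * c g - c k * c0 g) * g)"
      proof -
        have e: "c0 k * k = y * h0 - s0 - (\<Sum>g\<in>G'. c0 g * g)"
          using h0(4) G' by (simp add: algebra_simps)
        have "c0 k * y * h = c0 k * (s + (c k * k + (\<Sum>g\<in>G'. c g * g)))"
          using s(3) G' by (simp add: mult.assoc)
        also have "\<dots> = c0 k * s + c k * (c0 k * k) + c0 k * (\<Sum>g\<in>G'. c g * g)"
          by (simp add: algebra_simps)
        also have "\<dots> = s' + (c0 k * (\<Sum>g\<in>G'. c g * g) - c k * (\<Sum>g\<in>G'. c0 g * g))"
          unfolding e s'_def by (simp add: algebra_simps)
        also have "c0 k * (\<Sum>g\<in>G'. c g * g) - c k * (\<Sum>g\<in>G'. c0 g * g)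
            = (\<Sum>g\<in>G'. (c0 k * c g - c k * c0 g) * g)"
          by (simp add: sum_distrib_left sum_subtractf left_diff_distrib mult.assoc)
        finally show ?thesis .
      qed
      moreover have "\<forall>g\<in>G'. c0 k * c g - c k * c0 g \<in> R" using s h0 G' by auto
      ultimately show ?thesis
        by (intro bexI[of _ s'] exI[of _ "\<lambda>g. c0 k * c g - c k * c0 g"] conjI)
    qed
    have "\<exists>u X. u \<in> R \<and> u \<notin> P \<and> finite X \<and> X \<subseteq> J' \<and> card X < card H' + card G' \<and>
      (\<forall>h\<in>J'. \<exists>s\<in>ideal_gen R X. \<exists>p\<in>ideal_prod R P I. u * h = s + p)"
    proof (rule Suc.hyps(1)[OF f G'(3) _ H' yc])
      show "G' \<subseteq> I" using Suc.prems(2) G' by blast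
    qed (rule gen')
    moreover have "card H' + card G' \<le> card H + card G"
      using Suc.prems G' unfolding H'_def by (simp add: card_insert_if)
    ultimately show ?thesis by (elim exE) (intro exI, auto)
  qed
qed

section \<open>Growth of the powers of an ideal at a prime\<close>

text \<open>Iterating the reduction equation turns \<open>N\<close> factors from \<open>I\<close>
  into factors from \<open>J'\<close>; each of them becomes, at the cost of one factor
  \<open>u\<close>, a combination of \<open>X\<close> modulo \<open>P * I\<close>.\<close>

lemma power_mult_ideal_pow:
  assumes I: "is_ideal R I" and P: "is_ideal R P" and J': "is_ideal R J'"
    and red: "ideal_pow R I (Suc r) \<subseteq> ideal_prod R J' (ideal_pow R I r)"
    and W: "ideal_pow R I r = ideal_gen R W" "W \<subseteq> R"
    and X: "X \<subseteq> J'" "J' \<subseteq> I" and u: "u \<in> R"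
    and dec: "\<And>h. h \<in> J' \<Longrightarrow> \<exists>s\<in>ideal_gen R X. \<exists>p\<in>ideal_prod R P I. u * h = s + p"
    and f: "f \<in> ideal_pow R I (N + r)"
  shows "\<exists>b\<in>ideal_gen R {prod_mset A * w | A w. A \<in> multisets_of_size X N \<and> w \<in> W}.
    \<exists>q\<in>ideal_prod R P (ideal_pow R I (N + r)). u ^ N * f = b + q"
proof -
  define GG where "GG N = {prod_mset A * w | A w. A \<in> multisets_of_size X N \<and> w \<in> W}" for N
  define Y where "Y N = {b + q | b q. b \<in> ideal_gen R (GG N) \<and> q \<in> ideal_prod R P (ideal_pow R I (N + r))}" for N
  have IR: "I \<subseteq> R" and PR: "P \<subseteq> R" using I P by (auto simp: is_ideal_def)
  have XR: "X \<subseteq> R" using X IR by blast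
  have powi: "is_ideal R (ideal_pow R I k)" for k by (rule ideal_ideal_pow[OF IR])
  have powR: "ideal_pow R I k \<subseteq> R" for k using powi by (simp add: is_ideal_def)
  have prodA: "prod_mset A \<in> R" "prod_mset A \<in> ideal_pow R I N" if "A \<in> multisets_of_size X N" for A N
    using that X XR prod_mset_closed ideal_pow_prod_mset[OF I, of A] by (auto simp: multisets_of_size_def)
  have GGR: "GG N \<subseteq> R" for N using prodA W by (auto simp: GG_def)
  have GGi: "is_ideal R (ideal_gen R (GG N))" for N by (rule ideal_ideal_gen[OF GGR])
  have PIi: "is_ideal R (ideal_prod R P (ideal_pow R I k))" for k by (rule ideal_ideal_prod[OF PR powR])
  have Yi: "is_ideal R (Y N)" for N unfolding Y_def by (rule ideal_plus[OF GGi PIi])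
  have Yl: "b \<in> Y N" if "b \<in> ideal_gen R (GG N)" for b N
    unfolding Y_def using that ideal_zero[OF PIi] by (intro CollectI exI[of _ b] exI[of _ 0]) auto
  have Yr: "b \<in> Y N" if "b \<in> ideal_prod R P (ideal_pow R I (N + r))" for b N
    unfolding Y_def using that ideal_zero[OF GGi] by (intro CollectI exI[of _ 0] exI[of _ b]) auto
  \<comment> \<open>One more factor is moved into \<open>X\<close>: \<open>g\<close> is a sum of
    products of \<open>J'\<close> and \<open>I^r\<close>, and \<open>u\<close> times the factor in
    \<open>J'\<close> splits into a part in \<open>(X)\<close> and a part in
    \<open>P * I\<close>.\<close>
  have step: "g * (u * prod_mset A) \<in> Y (Suc N)"
    if A: "A \<in> multisets_of_size X N" and g: "g \<in> ideal_pow R I (Suc r)" for A N g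
  proof -
    have uA: "u * prod_mset A \<in> R" using prodA[OF A] u by auto
    have "ideal_prod R J' (ideal_pow R I r) \<subseteq> {g \<in> R. g * (u * prod_mset A) \<in> Y (Suc N)}"
    proof (rule ideal_prod_least[OF ideal_colon[OF Yi uA]])
      fix h v assume h: "h \<in> J'" and v: "v \<in> ideal_pow R I r"
      then have hv: "h \<in> R" "v \<in> R" using J' powR ideal_subset by blast+
      obtain s p where s: "s \<in> ideal_gen R X" "p \<in> ideal_prod R P I" "u * h = s + p" using dec[OF h] by blast
      have sv: "s * (v * prod_mset A) \<in> Y (Suc N)"
      proof -
        have "x * (v * prod_mset A) \<in> ideal_gen R (GG (Suc N))" if x: "x \<in> X" for x
        proof -
          have xA: "x * prod_mset A \<in> R" using x XR prodA[OF A] by auto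
          have "ideal_gen R W \<subseteq> {v \<in> R. v * (x * prod_mset A) \<in> ideal_gen R (GG (Suc N))}"
          proof (rule ideal_gen_least[OF ideal_colon[OF GGi xA]], safe)
            fix w assume w: "w \<in> W"
            then show "w \<in> R" using W by blast
            have "add_mset x A \<in> multisets_of_size X (Suc N)" using A x by (auto simp: multisets_of_size_def)
            then have "prod_mset (add_mset x A) * w \<in> GG (Suc N)" unfolding GG_def using w by blast
            then have "prod_mset (add_mset x A) * w \<in> ideal_gen R (GG (Suc N))"
              using ideal_gen_superset by blast
            then show "w * (x * prod_mset A) \<in> ideal_gen R (GG (Suc N))" by (simp add: mult_ac)
          qed
          then show ?thesis using v W by (auto simp: mult_ac)
        qed
        moreover have vA: "v * prod_mset A \<in> R" using hv prodA[OF A] by auto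
        ultimately have "ideal_gen R X \<subseteq> {x \<in> R. x * (v * prod_mset A) \<in> ideal_gen R (GG (Suc N))}"
          using XR by (intro ideal_gen_least[OF ideal_colon[OF GGi vA]]) auto
        then show ?thesis using s Yl by blast
      qed
      have pv: "p * (v * prod_mset A) \<in> Y (Suc N)"
      proof -
        have "p \<in> ideal_prod R P (ideal_pow R I (Suc 0))" using s ideal_pow_1_eq[OF I] by simp
        then have "p * (v * prod_mset A) \<in> ideal_prod R P (ideal_pow R I (Suc 0 + (r + N)))"
          using v prodA[OF A] by (intro ideal_prod_pow_mult[OF I PR] ideal_pow_add_mult[OF I]) auto
        moreover have "Suc 0 + (r + N) = Suc N + r" by simp
        ultimately show ?thesis by (intro Yr) (simp only:)
      qed
      have "h * v * (u * prod_mset A) = (u * h) * (v * prod_mset A)" by (simp add: mult_ac)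
      also have "\<dots> = s * (v * prod_mset A) + p * (v * prod_mset A)" using s by (simp add: distrib_right)
      also have "\<dots> \<in> Y (Suc N)" using sv pv by (rule ideal_add[OF Yi])
      finally show "h * v \<in> {g \<in> R. g * (u * prod_mset A) \<in> Y (Suc N)}" using hv by auto
    qed
    then show ?thesis using g red by blast
  qed
  have "u ^ N * f \<in> Y N" using f
  proof (induction N arbitrary: f)
    case 0
    have "W \<subseteq> GG 0" unfolding GG_def by force
    from ideal_gen_mono[OF this] have "f \<in> ideal_gen R (GG 0)" using 0 W by auto
    then show ?case using Yl by simp
  next
    case (Suc N)
    have uN: "u ^ Suc N \<in> R" using u by blast
    \<comment> \<open>A factor \<open>a\<close> from \<open>I\<close> is split off and the induction
      hypothesis is applied to the rest. The products \<open>a * w\<close> with \<open>w\<close> in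
      \<open>W\<close> lie in \<open>I^(r+1)\<close>, which is where \<open>step\<close>
      applies.\<close>
    have "ideal_prod R I (ideal_pow R I (N + r)) \<subseteq> {f \<in> R. f * u ^ Suc N \<in> Y (Suc N)}"
    proof (rule ideal_prod_least[OF ideal_colon[OF Yi uN]])
      fix a g assume a: "a \<in> I" and g: "g \<in> ideal_pow R I (N + r)"
      obtain b q where b: "b \<in> ideal_gen R (GG N)" "q \<in> ideal_prod R P (ideal_pow R I (N + r))"
        "u ^ N * g = b + q" using Suc.IH[OF g] unfolding Y_def by blast
      have aR: "a \<in> R" "g \<in> R" using a g IR powR by auto
      have au: "a * u \<in> R" using aR u by auto
      have "ideal_gen R (GG N) \<subseteq> {b \<in> R. b * (a * u) \<in> Y (Suc N)}"
      proof (rule ideal_gen_least[OF ideal_colon[OF Yi au]])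
        show "GG N \<subseteq> {b \<in> R. b * (a * u) \<in> Y (Suc N)}"
        proof
          fix x assume x: "x \<in> GG N"
          then obtain A w where xw: "x = prod_mset A * w" "A \<in> multisets_of_size X N" "w \<in> W"
            unfolding GG_def by blast
          have "w \<in> ideal_pow R I r" using xw W ideal_gen_superset by blast
          then have "a * w \<in> ideal_pow R I (Suc r)" using a by (auto intro: ideal_prod_memI)
          from step[OF xw(2) this] have "x * (a * u) \<in> Y (Suc N)" by (simp add: xw mult_ac)
          then show "x \<in> {b \<in> R. b * (a * u) \<in> Y (Suc N)}" using x GGR by blast
        qed
      qed
      then have 1: "b * (a * u) \<in> Y (Suc N)" using b by blast
      have "a \<in> ideal_pow R I (Suc 0)" using a ideal_pow_1_eq[OF I] by simp
      then have "q * a \<in> ideal_prod R P (ideal_pow R I (N + r + Suc 0))"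
        using b by (intro ideal_prod_pow_mult[OF I PR]) auto
      then have "q * a \<in> Y (Suc N)" by (intro Yr) simp
      then have 2: "u * (q * a) \<in> Y (Suc N)" using u ideal_mult_left[OF Yi] by blast
      have "a * g * u ^ Suc N = (u ^ N * g) * (a * u)" by (simp add: mult_ac)
      also have "\<dots> = b * (a * u) + u * (q * a)" using b by (simp add: algebra_simps)
      also have "\<dots> \<in> Y (Suc N)" using 1 2 by (rule ideal_add[OF Yi])
      finally show "a * g \<in> {f \<in> R. f * u ^ Suc N \<in> Y (Suc N)}" using aR by auto
    qed
    then show ?case using Suc.prems by (auto simp: mult.commute)
  qed
  then obtain b q where "b \<in> ideal_gen R (GG N)" "q \<in> ideal_prod R P (ideal_pow R I (N + r))"
    "u ^ N * f = b + q" unfolding Y_def by blast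
  then show ?thesis unfolding GG_def by (intro bexI[of _ b] bexI[of _ q])
qed

text \<open>For large \<open>N\<close> there are more monomials of degree \<open>N + r\<close> in
  the elements \<open>a i\<close> than products of \<open>N\<close> elements of \<open>X\<close>
  with an element of \<open>W\<close>. The latter span all of them modulo \<open>P * I^(N+r)\<close>
  after multiplication by \<open>u ^ N\<close>, so a nontrivial relation exists.\<close>

lemma monomials_dependent_mod_prime:
  fixes a :: "'i \<Rightarrow> 'b"
  assumes I: "is_ideal R I" and P: "prime_in P" and J': "is_ideal R J'"
    and red: "ideal_pow R I (Suc r) \<subseteq> ideal_prod R J' (ideal_pow R I r)"
    and W: "ideal_pow R I r = ideal_gen R W" "W \<subseteq> R" "finite W"
    and X: "X \<subseteq> J'" "J' \<subseteq> I" "finite X" and u: "u \<in> R" "u \<notin> P"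
    and dec: "\<And>h. h \<in> J' \<Longrightarrow> \<exists>s\<in>ideal_gen R X. \<exists>p\<in>ideal_prod R P I. u * h = s + p"
    and A: "finite A" "card X < card A" "a ` A \<subseteq> I"
  shows "\<exists>M z. (\<forall>Z\<in>multisets_of_size A M. z Z \<in> R) \<and> (\<exists>Z\<in>multisets_of_size A M. z Z \<notin> P) \<and>
    (\<Sum>Z\<in>multisets_of_size A M. z Z * prod_mset (image_mset a Z)) \<in> ideal_prod R P (ideal_pow R I M)"
proof -
  obtain N where N: "card W * ((card X + N - 1) choose N) < (card A + (N + r) - 1) choose (N + r)"
    using binomial_growth[OF A(2)] by blast
  define E where "E = multisets_of_size A (N + r)"
  define S where "S = multisets_of_size X N \<times> W"
  define g where "g = (\<lambda>(B, w). prod_mset B * (w::'b))"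
  define mu where "mu Z = prod_mset (image_mset a Z)" for Z
  have Pi: "is_ideal R P" using P by (simp add: prime_in_def)
  have IR: "I \<subseteq> R" and PR: "P \<subseteq> R" using I Pi by (auto simp: is_ideal_def)
  have fin: "finite E" "finite S" unfolding E_def S_def using A X W by auto
  have "card S = ((card X + N - 1) choose N) * card W"
    unfolding S_def using X by (simp add: card_cartesian_product card_multisets_of_size)
  then have card: "card S < card E" unfolding E_def using N A by (simp add: card_multisets_of_size mult.commute)
  have gS: "g ` S = {prod_mset B * w | B w. B \<in> multisets_of_size X N \<and> w \<in> W}"
    unfolding g_def S_def by auto
  have gR: "g ` S \<subseteq> R"
  proof -
    have "prod_mset B \<in> R" if "B \<in> multisets_of_size X N" for B
      using that X IR by (intro prod_mset_closed) (auto simp: multisets_of_size_def)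
    then show ?thesis unfolding gS using W(2) by auto
  qed
  have PIi: "is_ideal R (ideal_prod R P (ideal_pow R I (N + r)))"
    using PR ideal_ideal_pow[OF IR] by (intro ideal_ideal_prod) (auto simp: is_ideal_def)
  have "\<exists>c. (\<forall>s\<in>S. c s \<in> R) \<and> u ^ N * mu Z - (\<Sum>s\<in>S. c s * g s) \<in> ideal_prod R P (ideal_pow R I (N + r))"
    if Z: "Z \<in> E" for Z
  proof -
    have "mu Z \<in> ideal_pow R I (size (image_mset a Z))"
      unfolding mu_def using Z A(3) by (intro ideal_pow_prod_mset[OF I]) (auto simp: E_def multisets_of_size_def)
    then have "mu Z \<in> ideal_pow R I (N + r)" using Z by (simp add: E_def multisets_of_size_def)
    from power_mult_ideal_pow[OF I Pi J' red W(1,2) X(1,2) u(1) dec this]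
    obtain b q where b: "b \<in> ideal_gen R (g ` S)" "q \<in> ideal_prod R P (ideal_pow R I (N + r))"
      "u ^ N * mu Z = b + q" unfolding gS by blast
    obtain c where "\<And>s. s \<in> S \<Longrightarrow> c s \<in> R" "b = (\<Sum>s\<in>S. c s * g s)"
      using ideal_gen_image_obtain[OF b(1) fin(2) gR] by blast
    then show ?thesis using b by (intro exI[of _ c]) auto
  qed
  then obtain c where c: "\<And>Z s. Z \<in> E \<Longrightarrow> s \<in> S \<Longrightarrow> c Z s \<in> R"
    "\<And>Z. Z \<in> E \<Longrightarrow> u ^ N * mu Z - (\<Sum>s\<in>S. c Z s * g s) \<in> ideal_prod R P (ideal_pow R I (N + r))"
    by metis
  obtain y where y: "\<forall>Z\<in>E. y Z \<in> R" "\<exists>Z\<in>E. y Z \<notin> P" "\<forall>s\<in>S. (\<Sum>Z\<in>E. y Z * c Z s) \<in> P"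
    using linear_system_mod_prime[OF P fin(2,1) card, of c] c(1) by blast
  have gI: "g s \<in> ideal_pow R I (N + r)" if sS: "s \<in> S" for s
  proof -
    obtain B w where s: "s = (B, w)" "B \<in> multisets_of_size X N" "w \<in> W" using sS by (auto simp: S_def)
    have "prod_mset B \<in> ideal_pow R I N"
      using s X ideal_pow_prod_mset[OF I, of B] by (auto simp: multisets_of_size_def)
    moreover have "w \<in> ideal_pow R I r" using W s ideal_gen_superset by blast
    ultimately show ?thesis unfolding s g_def using ideal_pow_add_mult[OF I] by auto
  qed
  \<comment> \<open>The first sum collects the errors in \<open>P * I^(N+r)\<close>. In the second,
    the coefficient of each \<open>g s\<close> lies in \<open>P\<close> by the choice of
    \<open>y\<close>, while \<open>g s\<close> lies in \<open>I^(N+r)\<close>.\<close>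
  have "(\<Sum>Z\<in>E. (u ^ N * y Z) * mu Z) =
      (\<Sum>Z\<in>E. y Z * (u ^ N * mu Z - (\<Sum>s\<in>S. c Z s * g s))) + (\<Sum>s\<in>S. (\<Sum>Z\<in>E. y Z * c Z s) * g s)"
  proof -
    have "(\<Sum>s\<in>S. (\<Sum>Z\<in>E. y Z * c Z s) * g s) = (\<Sum>Z\<in>E. y Z * (\<Sum>s\<in>S. c Z s * g s))"
      unfolding sum_distrib_right sum_distrib_left by (subst sum.swap) (simp add: mult.assoc)
    then show ?thesis by (simp add: right_diff_distrib sum_subtractf mult_ac)
  qed
  also have "\<dots> \<in> ideal_prod R P (ideal_pow R I (N + r))"
    using y c gI by (intro ideal_add[OF PIi] ideal_sum[OF PIi] ideal_mult_left[OF PIi] ideal_prod_memI) auto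
  finally have "(\<Sum>Z\<in>E. (u ^ N * y Z) * mu Z) \<in> ideal_prod R P (ideal_pow R I (N + r))" .
  moreover have "\<exists>Z\<in>E. u ^ N * y Z \<notin> P"
  proof -
    obtain Z where Z: "Z \<in> E" "y Z \<notin> P" using y by blast
    moreover have "u ^ N \<notin> P" using prime_in_power[OF P u(1)] u(2) by blast
    ultimately have "u ^ N * y Z \<notin> P" using P y(1) u unfolding prime_in_def by blast
    then show ?thesis using Z by blast
  qed
  moreover have "\<forall>Z\<in>E. u ^ N * y Z \<in> R" using y u by auto
  ultimately show ?thesis unfolding E_def mu_def
    by (intro exI[of _ "N + r"] exI[of _ "\<lambda>Z. u ^ N * y Z"] conjI)
qed

end

subsection \<open>Initial coefficients with respect to a weight\<close>

lemma mpoly_expand: "f = (\<Sum>t\<in>Poly_Mapping.keys f. Poly_Mapping.single t (Poly_Mapping.lookup f t))"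
proof (rule poly_mapping_eqI)
  fix k
  have "Poly_Mapping.lookup (\<Sum>t\<in>Poly_Mapping.keys f. Poly_Mapping.single t (Poly_Mapping.lookup f t)) k
    = (\<Sum>t\<in>Poly_Mapping.keys f. if t = k then Poly_Mapping.lookup f t else 0)"
    unfolding lookup_sum by (rule sum.cong) (auto simp: lookup_single when_def)
  also have "\<dots> = Poly_Mapping.lookup f k" by (simp add: in_keys_iff)
  finally show "Poly_Mapping.lookup f k =
    Poly_Mapping.lookup (\<Sum>t\<in>Poly_Mapping.keys f. Poly_Mapping.single t (Poly_Mapping.lookup f t)) k" ..
qed

lemma keys_mult_obtain:
  assumes "t \<in> Poly_Mapping.keys (f * g)"
  obtains a b where "t = a + b" "a \<in> Poly_Mapping.keys f" "b \<in> Poly_Mapping.keys g"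
  using assms keys_mult[of f g] by blast

lemma keys_add_nat: "Poly_Mapping.keys (a + b :: nat \<Rightarrow>\<^sub>0 nat) = Poly_Mapping.keys a \<union> Poly_Mapping.keys b"
  by (auto simp: in_keys_iff lookup_add)

interpretation polyring: subring_set "polyring m :: 'a::comm_ring_1 mpoly set" for m
proof
  show "1 \<in> (polyring m :: 'a mpoly set)" by (simp add: polyring_def)
  fix a b :: "'a mpoly" assume ab: "a \<in> polyring m" "b \<in> polyring m"
  have "Poly_Mapping.keys (a - b) \<subseteq> Poly_Mapping.keys a \<union> Poly_Mapping.keys b"
    by (auto simp: in_keys_iff lookup_minus)
  then show "a - b \<in> polyring m" using ab unfolding polyring_def by blast
  show "a * b \<in> polyring m" unfolding polyring_def
  proof (intro CollectI ballI)
    fix t assume "t \<in> Poly_Mapping.keys (a * b)"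
    then obtain u v where "t = u + v" "u \<in> Poly_Mapping.keys a" "v \<in> Poly_Mapping.keys b"
      by (rule keys_mult_obtain)
    then show "Poly_Mapping.keys t \<subseteq> {1..m}" using ab by (auto simp: polyring_def keys_add_nat)
  qed
qed

lemma Var_in_polyring: "1 \<le> i \<Longrightarrow> i \<le> m \<Longrightarrow> Var i \<in> polyring m"
  by (auto simp: Var_def polyring_def)

section \<open>Coefficients with respect to the leading block of variables\<close>

definition headfree :: "nat \<Rightarrow> (nat \<Rightarrow>\<^sub>0 nat) \<Rightarrow> bool" where
  "headfree D t \<longleftrightarrow> (\<forall>i\<in>{1..D}. Poly_Mapping.lookup t i = 0)"

lemma headfree_add: "headfree D (s + t) \<longleftrightarrow> headfree D s \<and> headfree D t"
  by (auto simp: headfree_def lookup_add)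

text \<open>The coefficient of the monomial \<open>u\<close> when \<open>f\<close> is viewed as a polynomial in \<open>x\<^sub>1,\<dots>,x\<^sub>D\<close> over the
  ring of polynomials in the remaining variables.\<close>

definition coeff_part :: "nat \<Rightarrow> (nat \<Rightarrow>\<^sub>0 nat) \<Rightarrow> 'a::comm_ring_1 mpoly \<Rightarrow> 'a mpoly" where
  "coeff_part D u f = Abs_poly_mapping (\<lambda>s. if headfree D s then Poly_Mapping.lookup f (s + u) else 0)"

lemma lookup_coeff_part:
  "Poly_Mapping.lookup (coeff_part D u f) s = (if headfree D s then Poly_Mapping.lookup f (s + u) else 0)"
proof -
  have "finite ((\<lambda>s. s + u) -` Poly_Mapping.keys f)"
    by (rule finite_vimageI) (auto simp: inj_def)
  then have "finite {s. (if headfree D s then Poly_Mapping.lookup f (s + u) else 0) \<noteq> 0}"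
    by (rule rev_finite_subset) (auto simp: in_keys_iff)
  then show ?thesis unfolding coeff_part_def by simp
qed

lemma coeff_part_zero [simp]: "coeff_part D u 0 = 0"
  by (rule poly_mapping_eqI) (simp add: lookup_coeff_part)

lemma coeff_part_add: "coeff_part D u (f + g) = coeff_part D u f + coeff_part D u g"
  by (rule poly_mapping_eqI) (simp add: lookup_coeff_part lookup_add)

lemma coeff_part_sum: "coeff_part D u (sum f A) = (\<Sum>x\<in>A. coeff_part D u (f x))"
  by (induction A rule: infinite_finite_induct) (auto simp: coeff_part_add)

lemma coeff_part_single:
  "headfree D s \<Longrightarrow> coeff_part D u (Poly_Mapping.single (s + u) k) = Poly_Mapping.single s k"
  by (rule poly_mapping_eqI) (auto simp: lookup_coeff_part lookup_single when_def)

lemma coeff_part_eq_0: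
  "(\<And>s. headfree D s \<Longrightarrow> s + u \<notin> Poly_Mapping.keys f) \<Longrightarrow> coeff_part D u f = 0"
  by (rule poly_mapping_eqI) (auto simp: lookup_coeff_part in_keys_iff)

lemma keys_coeff_part:
  "s \<in> Poly_Mapping.keys (coeff_part D u f) \<Longrightarrow> headfree D s \<and> s + u \<in> Poly_Mapping.keys f"
  by (auto simp: in_keys_iff lookup_coeff_part split: if_splits)

lemma coeff_part_in_polyring: "f \<in> polyring m \<Longrightarrow> coeff_part D u f \<in> polyring m"
  unfolding polyring_def
proof (intro CollectI ballI)
  fix t assume f: "f \<in> {p. \<forall>t\<in>Poly_Mapping.keys p. Poly_Mapping.keys t \<subseteq> {1..m}}"
    and "t \<in> Poly_Mapping.keys (coeff_part D u f)"
  then have "t + u \<in> Poly_Mapping.keys f" using keys_coeff_part by blast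
  then have "Poly_Mapping.keys (t + u) \<subseteq> {1..m}" using f by blast
  then show "Poly_Mapping.keys t \<subseteq> {1..m}" by (simp add: keys_add_nat)
qed

text \<open>Taking a coefficient is linear over the polynomials in the remaining variables. Both
  sides are additive in \<open>q\<close> and \<open>f\<close>, so single monomials suffice.\<close>

lemma coeff_part_mult_headfree:
  assumes u: "Poly_Mapping.keys u \<subseteq> {1..D}" and q: "\<And>a. a \<in> Poly_Mapping.keys q \<Longrightarrow> headfree D a"
  shows "coeff_part D u (q * f) = q * coeff_part D u f"
proof -
  have mono: "coeff_part D u (Poly_Mapping.single a k * Poly_Mapping.single t l) =
      Poly_Mapping.single a k * coeff_part D u (Poly_Mapping.single t l)" if a: "headfree D a" for a t k l
  proof (cases "\<exists>s. headfree D s \<and> t = s + u")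
    case True
    then obtain s where s: "headfree D s" "t = s + u" by blast
    have "coeff_part D u (Poly_Mapping.single ((a + s) + u) (k * l)) = Poly_Mapping.single (a + s) (k * l)"
      using a s by (intro coeff_part_single) (simp add: headfree_add)
    then show ?thesis using s by (simp add: mult_single coeff_part_single add.assoc)
  next
    case False
    \<comment> \<open>As \<open>a\<close> does not involve the first \<open>D\<close> variables,
      \<open>t\<close> would have to agree with \<open>u\<close> there, and then
      \<open>t - u\<close> would be the \<open>s\<close> excluded by the case assumption.\<close>
    have "a + t \<noteq> s + u" if s: "headfree D s" for s
    proof
      assume eq: "a + t = s + u"
      have t: "Poly_Mapping.lookup t i = Poly_Mapping.lookup u i" if "i \<in> {1..D}" for i
        using arg_cong[OF eq, of "\<lambda>x. Poly_Mapping.lookup x i"] a s that by (simp add: lookup_add headfree_def)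
      have u0: "Poly_Mapping.lookup u i = 0" if "i \<notin> {1..D}" for i
        using u that by (auto simp: in_keys_iff)
      have "t = (t - u) + u"
        by (rule poly_mapping_eqI) (metis t u0 add.commute diff_add_inverse diff_zero lookup_add lookup_minus add.right_neutral add_diff_cancel_right' le_add_diff_inverse2 order_refl)
      moreover have "headfree D (t - u)" using t by (simp add: headfree_def lookup_minus)
      ultimately show False using False by blast
    qed
    then have "coeff_part D u (Poly_Mapping.single (a + t) (k * l)) = 0"
      by (intro coeff_part_eq_0) (metis empty_iff keys_single singletonD)
    moreover have "coeff_part D u (Poly_Mapping.single t l) = 0"
      using False by (intro coeff_part_eq_0) (auto split: if_splits)
    ultimately show ?thesis by (simp add: mult_single)
  qed
  let ?q = "\<lambda>a. Poly_Mapping.single a (Poly_Mapping.lookup q a)"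
  let ?f = "\<lambda>t. Poly_Mapping.single t (Poly_Mapping.lookup f t)"
  have "coeff_part D u (q * f) =
      coeff_part D u (\<Sum>a\<in>Poly_Mapping.keys q. \<Sum>t\<in>Poly_Mapping.keys f. ?q a * ?f t)"
    by (subst mpoly_expand[of q], subst mpoly_expand[of f]) (simp only: sum_product)
  also have "\<dots> = (\<Sum>a\<in>Poly_Mapping.keys q. \<Sum>t\<in>Poly_Mapping.keys f. ?q a * coeff_part D u (?f t))"
    unfolding coeff_part_sum using q by (intro sum.cong mono) auto
  also have "\<dots> = (\<Sum>a\<in>Poly_Mapping.keys q. ?q a) * coeff_part D u (\<Sum>t\<in>Poly_Mapping.keys f. ?f t)"
    by (simp only: coeff_part_sum sum_product)
  also have "\<dots> = q * coeff_part D u f"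
    by (simp only: mpoly_expand[symmetric])
  finally show ?thesis .
qed

section \<open>The weight and lowest-weight coefficients\<close>

text \<open>The weights 2, 1 and 0 are chosen so that all generators of the Ferrers ideal have
  weight at least 2, while the \<open>D\<close> elements to be proved independent are monomials of
  weight exactly 2. Their monomials of degree \<open>M\<close> thus have the least weight possible
  in \<open>I^M\<close>.\<close>

definition wt :: "nat \<Rightarrow> nat \<Rightarrow> (nat \<Rightarrow>\<^sub>0 nat) \<Rightarrow> nat" where
  "wt c D t = (\<Sum>i\<in>{1..D}. (if i \<le> c then 2 else 1) * Poly_Mapping.lookup t i)"

lemma wt_add: "wt c D (s + t) = wt c D s + wt c D t"
  by (simp add: wt_def lookup_add algebra_simps sum.distrib)

lemma wt_eq_0_iff: "wt c D t = 0 \<longleftrightarrow> headfree D t"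
  by (auto simp: wt_def headfree_def)

lemma wt_single: "wt c D (Poly_Mapping.single i 1) = (if i \<in> {1..D} then if i \<le> c then 2 else 1 else 0)"
proof -
  have "wt c D (Poly_Mapping.single i 1) = (\<Sum>k\<in>{1..D}. if k = i then if k \<le> c then 2 else 1 else 0)"
    unfolding wt_def by (rule sum.cong) (auto simp: lookup_single when_def)
  then show ?thesis by (simp only: sum.delta finite_atLeastAtMost)
qed

definition wt_ge :: "nat \<Rightarrow> nat \<Rightarrow> nat \<Rightarrow> 'a::comm_ring_1 mpoly \<Rightarrow> bool" where
  "wt_ge c D w f \<longleftrightarrow> (\<forall>t\<in>Poly_Mapping.keys f. w \<le> wt c D t)"

lemma wt_ge_mult: "wt_ge c D v f \<Longrightarrow> wt_ge c D w g \<Longrightarrow> wt_ge c D (v + w) (f * g)"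
  unfolding wt_ge_def by (metis keys_mult_obtain wt_add add_mono)

lemma wt_ge_0: "wt_ge c D 0 f"
  by (simp add: wt_ge_def)

lemma wt_ge_add: "wt_ge c D w f \<Longrightarrow> wt_ge c D w g \<Longrightarrow> wt_ge c D w (f + g)"
  unfolding wt_ge_def using keys_add[of f g] by blast

lemma ideal_wt_ge: "is_ideal (polyring m) {f \<in> polyring m. wt_ge c D w f}"
proof (rule polyring.is_idealI)
  show "0 \<in> {f \<in> polyring m. wt_ge c D w f}" by (simp add: wt_ge_def)
  fix r f :: "'a mpoly" assume "r \<in> polyring m" "f \<in> {f \<in> polyring m. wt_ge c D w f}"
  then show "r * f \<in> {f \<in> polyring m. wt_ge c D w f}" using wt_ge_mult[OF wt_ge_0[of c D r]] by auto
qed (auto intro: wt_ge_add)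

lemma wt_ge_ideal_pow:
  assumes "I \<subseteq> {f \<in> polyring m. wt_ge c D w f}"
  shows "ideal_pow (polyring m) I k \<subseteq> {f \<in> polyring m. wt_ge c D (k * w) f}"
proof (induction k)
  case (Suc k)
  have "ideal_prod (polyring m) I (ideal_pow (polyring m) I k) \<subseteq> {f \<in> polyring m. wt_ge c D (Suc k * w) f}"
  proof (rule polyring.ideal_prod_least[OF ideal_wt_ge])
    fix a b assume "a \<in> I" "b \<in> ideal_pow (polyring m) I k"
    then have "a \<in> polyring m" "wt_ge c D w a" "b \<in> polyring m" "wt_ge c D (k * w) b" using assms Suc by auto
    then show "a * b \<in> {f \<in> polyring m. wt_ge c D (Suc k * w) f}" using wt_ge_mult by fastforce
  qed
  then show ?case by simp
qed (auto simp: wt_ge_0)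

lemma coeff_part_eq_0_wt:
  assumes "wt_ge c D w f" "wt c D u < w"
  shows "coeff_part D u f = 0"
proof (rule coeff_part_eq_0)
  fix s assume "headfree D s"
  then have "wt c D (s + u) = wt c D u" by (simp add: wt_add wt_eq_0_iff)
  then show "s + u \<notin> Poly_Mapping.keys f" using assms unfolding wt_ge_def by force
qed

lemma wt_ge_minus_coeff_part: "wt_ge c D 1 (f - coeff_part D 0 f)"
  unfolding wt_ge_def
proof
  fix t assume "t \<in> Poly_Mapping.keys (f - coeff_part D 0 f)"
  then have "\<not> headfree D t" by (auto simp: in_keys_iff lookup_minus lookup_coeff_part)
  then have "wt c D t \<noteq> 0" by (simp add: wt_eq_0_iff)
  then show "1 \<le> wt c D t" by simp
qed

text \<open>Since \<open>f\<close> has no terms of weight below that of \<open>u\<close>, terms of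
  \<open>p\<close> of positive weight cannot contribute to the coefficient at \<open>u\<close>; what
  remains of \<open>p\<close> is \<open>coeff_part D 0 p\<close>.\<close>

lemma coeff_part_mult:
  assumes u: "Poly_Mapping.keys u \<subseteq> {1..D}" and f: "wt_ge c D (wt c D u) f"
  shows "coeff_part D u (p * f) = coeff_part D 0 p * coeff_part D u f"
proof -
  have "p * f = coeff_part D 0 p * f + (p - coeff_part D 0 p) * f"
    by (simp add: algebra_simps)
  moreover have "coeff_part D u ((p - coeff_part D 0 p) * f) = 0"
    by (rule coeff_part_eq_0_wt[OF wt_ge_mult[OF wt_ge_minus_coeff_part f]]) simp
  moreover have "coeff_part D u (coeff_part D 0 p * f) = coeff_part D 0 p * coeff_part D u f"
    using keys_coeff_part by (intro coeff_part_mult_headfree[OF u]) blast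
  ultimately show ?thesis by (simp add: coeff_part_add)
qed

text \<open>Each monomial of positive weight is divisible by one of the first \<open>D\<close>
  variables.\<close>

lemma in_ideal_if_wt_ge_1:
  assumes P: "is_ideal (polyring m) P" and x: "\<And>i. i \<in> {1..D} \<Longrightarrow> Var i \<in> P"
    and f: "f \<in> polyring m" "wt_ge c D 1 f"
  shows "f \<in> P"
proof -
  have "Poly_Mapping.single t (Poly_Mapping.lookup f t) \<in> P" if t: "t \<in> Poly_Mapping.keys f" for t
  proof -
    have "wt c D t \<noteq> 0" using f(2) t unfolding wt_ge_def by force
    then obtain i where i: "i \<in> {1..D}" "Poly_Mapping.lookup t i \<noteq> 0"
      by (auto simp: wt_eq_0_iff headfree_def)
    define s where "s = t - Poly_Mapping.single i 1"
    have ts: "t = Poly_Mapping.single i 1 + s"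
      unfolding s_def by (rule poly_mapping_eqI) (use i in \<open>auto simp: lookup_add lookup_minus lookup_single when_def\<close>)
    have "Poly_Mapping.keys t \<subseteq> {1..m}" using f t unfolding polyring_def by blast
    then have "Poly_Mapping.keys s \<subseteq> {1..m}" unfolding ts by (simp add: keys_add_nat)
    then have "Poly_Mapping.single s (Poly_Mapping.lookup f t) \<in> polyring m" by (auto simp: polyring_def)
    then have "Poly_Mapping.single s (Poly_Mapping.lookup f t) * Var i \<in> P"
      using x[OF i(1)] polyring.ideal_mult_left[OF P] by blast
    moreover have "Poly_Mapping.single s (Poly_Mapping.lookup f t) * Var i = Poly_Mapping.single t (Poly_Mapping.lookup f t)"
      unfolding Var_def mult_single by (simp add: ts add.commute)
    ultimately show ?thesis by simp
  qed
  then have "(\<Sum>t\<in>Poly_Mapping.keys f. Poly_Mapping.single t (Poly_Mapping.lookup f t)) \<in> P"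
    by (rule polyring.ideal_sum[OF P])
  then show ?thesis by (simp only: mpoly_expand[symmetric])
qed

lemma coeff_part_0_in_ideal_iff:
  assumes P: "is_ideal (polyring m) P" and x: "\<And>i. i \<in> {1..D} \<Longrightarrow> Var i \<in> P"
    and f: "f \<in> polyring m"
  shows "coeff_part D 0 f \<in> P \<longleftrightarrow> f \<in> P"
proof -
  have "f - coeff_part D 0 f \<in> P"
    using f by (intro in_ideal_if_wt_ge_1[OF P x _ wt_ge_minus_coeff_part]) (auto intro: coeff_part_in_polyring)
  then show ?thesis
    using polyring.ideal_add[OF P, of "coeff_part D 0 f" "f - coeff_part D 0 f"]
      polyring.ideal_diff[OF P, of f "f - coeff_part D 0 f"] by auto
qed

text \<open>Elements of \<open>I^M\<close> have weight at least \<open>2 * M\<close>, so the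
  coefficient at a monomial of that weight is multiplicative on \<open>p * b\<close>, and its first
  factor is congruent to \<open>p\<close> modulo \<open>P\<close>.\<close>

lemma coeff_part_ideal_prod:
  assumes P: "is_ideal (polyring m) P" and x: "\<And>i. i \<in> {1..D} \<Longrightarrow> Var i \<in> P"
    and I: "I \<subseteq> {f \<in> polyring m. wt_ge c D 2 f}"
    and u: "Poly_Mapping.keys u \<subseteq> {1..D}" "wt c D u = 2 * M"
    and f: "f \<in> ideal_prod (polyring m) P (ideal_pow (polyring m) I M)"
  shows "coeff_part D u f \<in> P"
proof -
  let ?R = "polyring m :: 'a mpoly set"
  \<comment> \<open>Including the weight bound in \<open>K\<close> makes
    \<open>coeff_part_mult\<close> applicable, which gives closure under multiplication by the
    ring.\<close>
  define K where "K = {f \<in> {f \<in> ?R. wt_ge c D (2 * M) f}. coeff_part D u f \<in> P}"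
  note W = ideal_wt_ge[of m c D "2 * M", where 'a = 'a]
  have K: "is_ideal ?R K"
  proof (rule polyring.is_idealI)
    show "0 \<in> K" unfolding K_def using polyring.ideal_zero[OF W] polyring.ideal_zero[OF P] by simp
    fix a b assume "a \<in> K" "b \<in> K"
    then show "a + b \<in> K" unfolding K_def
      using polyring.ideal_add[OF W] polyring.ideal_add[OF P] by (simp add: coeff_part_add)
  next
    fix r a assume ra: "r \<in> ?R" "a \<in> K"
    then have "coeff_part D u (r * a) = coeff_part D 0 r * coeff_part D u a"
      using coeff_part_mult[OF u(1), of c a r] u(2) by (simp add: K_def)
    moreover have "coeff_part D 0 r * coeff_part D u a \<in> P"
      using ra polyring.ideal_mult_left[OF P coeff_part_in_polyring[OF ra(1)]] by (simp add: K_def)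
    ultimately show "r * a \<in> K" using ra polyring.ideal_mult_left[OF W, of r a] unfolding K_def by auto
  qed (auto simp: K_def)
  have "ideal_prod ?R P (ideal_pow ?R I M) \<subseteq> K"
  proof (rule polyring.ideal_prod_least[OF K])
    fix p b assume p: "p \<in> P" and b: "b \<in> ideal_pow ?R I M"
    have pR: "p \<in> ?R" using p polyring.ideal_subset[OF P] by blast
    have b': "b \<in> {f \<in> ?R. wt_ge c D (2 * M) f}" using b wt_ge_ideal_pow[OF I, of M] by (auto simp: mult.commute)
    then have "p * b \<in> {f \<in> ?R. wt_ge c D (2 * M) f}" using pR polyring.ideal_mult_left[OF W] by blast
    moreover have "coeff_part D u (p * b) = coeff_part D 0 p * coeff_part D u b"
      using coeff_part_mult[OF u(1), of c b p] u(2) b' by simp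
    moreover have "coeff_part D 0 p \<in> P" using coeff_part_0_in_ideal_iff[OF P x pR] p by simp
    moreover have "coeff_part D u b \<in> ?R" using b' by (auto intro: coeff_part_in_polyring)
    ultimately show "p * b \<in> K"
      using polyring.ideal_mult_right[OF P] unfolding K_def by auto
  qed
  then show ?thesis using f unfolding K_def by blast
qed

text \<open>Up to powers of \<open>y\<close>, distinct multisets give distinct monomials in the
  first \<open>D\<close> variables. Extracting the coefficient at the monomial of \<open>Z\<close>
  isolates \<open>z Z\<close> times a power of \<open>y\<close>, and \<open>y\<close> lies outside
  the prime.\<close>

lemma monomials_independent_mod_prime:
  fixes P I :: "'a::comm_ring_1 mpoly set" and c D m M :: nat and s :: "nat \<Rightarrow>\<^sub>0 nat"
  defines "y \<equiv> Poly_Mapping.single s 1 :: 'a mpoly"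
  defines "a \<equiv> (\<lambda>i. if i \<le> c then Var i * y else Var (Suc c) * Var i)"
  assumes P: "polyring.prime_in m P" and x: "\<And>i. i \<in> {1..D} \<Longrightarrow> Var i \<in> P"
    and I: "I \<subseteq> {f \<in> polyring m. wt_ge c D 2 f}"
    and y: "headfree D s" "y \<in> polyring m" "y \<notin> P"
    and z: "\<And>Z. Z \<in> multisets_of_size {1..D} M \<Longrightarrow> z Z \<in> polyring m"
    and mem: "(\<Sum>Z\<in>multisets_of_size {1..D} M. z Z * prod_mset (image_mset a Z))
      \<in> ideal_prod (polyring m) P (ideal_pow (polyring m) I M)"
    and Z: "Z \<in> multisets_of_size {1..D} M"
  shows "z Z \<in> P"
proof -
  let ?R = "polyring m :: 'a mpoly set"
  let ?E = "multisets_of_size {1..D} M"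
  have Pi: "is_ideal ?R P" using P by (simp add: polyring.prime_in_def)
  \<comment> \<open>The exponent of \<open>a i\<close> with the factor \<open>y\<close> removed;
    \<open>k\<close> counts how often that factor occurs.\<close>
  define th where "th i = (if i \<le> c then Poly_Mapping.single i 1
    else Poly_Mapping.single (Suc c) 1 + Poly_Mapping.single i 1 :: nat \<Rightarrow>\<^sub>0 nat)" for i
  define T where "T Z = sum_mset (image_mset th Z)" for Z
  define k where "k Z = size (filter_mset (\<lambda>i. i \<le> c) Z)" for Z :: "nat multiset"
  have mono: "prod_mset (image_mset a Z) = y ^ k Z * Poly_Mapping.single (T Z) 1" for Z
  proof (induction Z)
    case (add i Z)
    have "a i = (if i \<le> c then y else 1) * Poly_Mapping.single (th i) 1"
      unfolding a_def th_def Var_def by (simp add: mult_single mult.commute add.commute)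
    then have "prod_mset (image_mset a (add_mset i Z)) =
        ((if i \<le> c then y else 1) * y ^ k Z) * (Poly_Mapping.single (th i) 1 * Poly_Mapping.single (T Z) 1)"
      using add by (simp add: mult_ac)
    then show ?case by (simp add: mult_single T_def k_def)
  qed (simp add: T_def k_def)
  have T: "Poly_Mapping.keys (T Z) \<subseteq> {1..D} \<and> wt c D (T Z) = 2 * size Z" if "set_mset Z \<subseteq> {1..D}" for Z
    using that
  proof (induction Z)
    case (add i Z)
    have "Poly_Mapping.keys (th i) \<subseteq> {1..D}" using add.prems by (auto simp: th_def keys_add_nat)
    moreover have "wt c D (th i) = 2" using add.prems wt_single[of c D i] wt_single[of c D "Suc c"]
      by (simp add: th_def wt_add)
    ultimately show ?case using add by (simp add: T_def keys_add_nat wt_add)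
  qed (simp add: T_def wt_eq_0_iff headfree_def)
  \<comment> \<open>The variable with index \<open>Suc c\<close> is exceptional: it divides every
    \<open>a i\<close> with \<open>i > c\<close>. The multiplicity of \<open>Suc c\<close> in
    \<open>Z\<close> is recovered from the size of \<open>Z\<close> instead.\<close>
  have count_T: "Poly_Mapping.lookup (T Z) i = count Z i" if "i \<noteq> Suc c" for Z i
  proof (induction Z)
    case (add j Z)
    then show ?case using that by (auto simp: T_def th_def lookup_add lookup_single when_def)
  qed (simp add: T_def)
  have inj: "Z1 = Z2" if "T Z1 = T Z2" "size Z1 = size Z2" for Z1 Z2
  proof -
    have eq: "count Z1 i = count Z2 i" if "i \<noteq> Suc c" for i
      using count_T[OF that] \<open>T Z1 = T Z2\<close> by metis
    have "filter_mset (\<lambda>i. i \<noteq> Suc c) Z1 = filter_mset (\<lambda>i. i \<noteq> Suc c) Z2"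
      by (rule multiset_eqI) (auto simp: eq)
    moreover have "size Z = size (filter_mset (\<lambda>i. i \<noteq> Suc c) Z) + count Z (Suc c)" for Z
      by (induction Z) auto
    ultimately have "count Z1 (Suc c) = count Z2 (Suc c)" using that(2) by (metis add_left_cancel)
    then show ?thesis using eq by (metis multiset_eqI)
  qed
  have Zs: "set_mset Z \<subseteq> {1..D}" "size Z = M" using Z by (auto simp: multisets_of_size_def)
  have u: "Poly_Mapping.keys (T Z) \<subseteq> {1..D}" "wt c D (T Z) = 2 * M" using T[OF Zs(1)] Zs(2) by auto
  have yk: "headfree D t" if "t \<in> Poly_Mapping.keys (y ^ n)" for t n
    using that
  proof (induction n arbitrary: t)
    case (Suc n)
    then obtain v w where vw: "t = v + w" "v \<in> Poly_Mapping.keys y" "w \<in> Poly_Mapping.keys (y ^ n)"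
      by (auto elim: keys_mult_obtain)
    then have "v = s" unfolding y_def by (auto split: if_splits)
    then show ?case using vw Suc.IH y(1) by (simp add: headfree_add)
  qed (simp add: headfree_def)
  have part: "coeff_part D (T Z) (z Z' * prod_mset (image_mset a Z')) =
      (if Z' = Z then coeff_part D 0 (z Z) * y ^ k Z else 0)" if Z': "Z' \<in> ?E" for Z'
  proof -
    have Z's: "set_mset Z' \<subseteq> {1..D}" "size Z' = M" using Z' by (auto simp: multisets_of_size_def)
    have w: "wt_ge c D (wt c D (T Z)) (Poly_Mapping.single (T Z') 1 :: 'a mpoly)"
      using T[OF Z's(1)] Z's(2) u(2) by (auto simp: wt_ge_def)
    have "wt_ge c D (wt c D (T Z)) (y ^ k Z' * Poly_Mapping.single (T Z') 1 :: 'a mpoly)"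
      using wt_ge_mult[OF wt_ge_0 w] by simp
    then have "coeff_part D (T Z) (z Z' * prod_mset (image_mset a Z')) =
        coeff_part D 0 (z Z') * coeff_part D (T Z) (y ^ k Z' * Poly_Mapping.single (T Z') 1)"
      unfolding mono by (rule coeff_part_mult[OF u(1)])
    also have "coeff_part D (T Z) (y ^ k Z' * Poly_Mapping.single (T Z') 1) =
        y ^ k Z' * coeff_part D (T Z) (Poly_Mapping.single (T Z') 1)"
      using yk by (rule coeff_part_mult_headfree[OF u(1)])
    also have "coeff_part D (T Z) (Poly_Mapping.single (T Z') 1) = (if Z' = Z then 1 else 0 :: 'a mpoly)"
    proof (cases "Z' = Z")
      case True
      then show ?thesis using coeff_part_single[of D 0 "T Z" "1::'a"] by (simp add: headfree_def)
    next
      case False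
      \<comment> \<open>Both exponents are supported on the first \<open>D\<close> variables, so
        \<open>v\<close> would be zero and injectivity would give equal multisets.\<close>
      have "v + T Z \<noteq> T Z'" if v: "headfree D v" for v
      proof
        assume eq: "v + T Z = T Z'"
        then have "Poly_Mapping.keys v \<subseteq> {1..D}" using T[OF Z's(1)] by (metis Un_subset_iff keys_add_nat)
        then have "Poly_Mapping.lookup v i = 0" for i
          using v unfolding headfree_def by (metis in_keys_iff subsetD)
        then have "v = 0" by (intro poly_mapping_eqI) simp
        then show False using inj[of Z' Z] eq False Zs Z's by simp
      qed
      then show ?thesis using False by (auto intro!: coeff_part_eq_0 split: if_splits)
    qed
    finally show ?thesis by simp
  qed
  have "coeff_part D (T Z) (\<Sum>Z'\<in>?E. z Z' * prod_mset (image_mset a Z')) =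
      (\<Sum>Z'\<in>?E. if Z' = Z then coeff_part D 0 (z Z) * y ^ k Z else 0)"
    unfolding coeff_part_sum by (rule sum.cong[OF refl part])
  also have "\<dots> = coeff_part D 0 (z Z) * y ^ k Z"
    using Z by (simp add: finite_multisets_of_size)
  finally have "coeff_part D 0 (z Z) * y ^ k Z \<in> P"
    using coeff_part_ideal_prod[OF Pi x I u mem] by simp
  moreover have "y ^ k Z \<notin> P" using polyring.prime_in_power[OF P y(2)] y(3) by blast
  ultimately have "coeff_part D 0 (z Z) \<in> P"
    using P z[OF Z] y(2) coeff_part_in_polyring[OF z[OF Z]] unfolding polyring.prime_in_def by blast
  then show ?thesis using coeff_part_0_in_ideal_iff[OF Pi x z[OF Z]] by simp
qed

subsection \<open>Specialized Ferrers ideals\<close>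

lemma Var_mult_in_ferrers_gens:
  "1 \<le> i \<Longrightarrow> i \<le> n \<Longrightarrow> i \<le> j \<Longrightarrow> j \<le> lam i \<Longrightarrow> Var i * Var j \<in> ferrers_gens n lam"
  unfolding ferrers_gens_def by (intro CollectI exI[of _ i] exI[of _ j]) auto

lemma wt_ge_Var: "wt_ge c D (if i \<in> {1..D} then if i \<le> c then 2 else 1 else 0) (Var i)"
  unfolding wt_ge_def Var_def keys_single using wt_single[of c D i] by simp

lemma wt_ge_weaken: "wt_ge c D v f \<Longrightarrow> w \<le> v \<Longrightarrow> wt_ge c D w f"
  unfolding wt_ge_def by (meson order_trans)

locale ferrers =
  fixes n m :: nat and lam :: "nat \<Rightarrow> nat"
  assumes n: "1 \<le> n"
    and lam_antimono: "\<And>i j. 1 \<le> i \<Longrightarrow> i \<le> j \<Longrightarrow> j \<le> n \<Longrightarrow> lam j \<le> lam i"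
    and lam_1: "lam 1 = m"
    and lam_n: "lam n \<ge> n"
begin

lemma lam_bounds: "1 \<le> i \<Longrightarrow> i \<le> n \<Longrightarrow> n \<le> lam i \<and> lam i \<le> m"
  using lam_antimono[of i n] lam_antimono[of 1 i] lam_1 lam_n by auto

abbreviation R :: "'a::field mpoly set" where "R \<equiv> polyring m"
abbreviation I :: "'a::field mpoly set" where "I \<equiv> ideal_gen R (ferrers_gens n lam)"
abbreviation J :: "'a::field mpoly set" where "J \<equiv> ideal_gen R (diag_poly n lam ` {0..<m})"

lemma finite_gens: "finite (ferrers_gens n lam)"
proof -
  have "ferrers_gens n lam \<subseteq> (\<lambda>(i, j). Var i * Var j) ` ({1..n} \<times> {..m})"
    unfolding ferrers_gens_def using lam_bounds by fastforce
  then show ?thesis by (rule finite_subset) auto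
qed

lemma gens_subset: "ferrers_gens n lam \<subseteq> R"
  unfolding ferrers_gens_def
proof safe
  fix i j assume "1 \<le> i" "i \<le> n" "i - 1 < j" "j \<le> lam i"
  then have "1 \<le> j" "i \<le> m" "j \<le> m" using lam_bounds[of i] by auto
  then show "Var i * Var j \<in> R" using \<open>1 \<le> i\<close> by (intro polyring.mult_closed Var_in_polyring)
qed

lemma ideal_I: "is_ideal R I"
  by (rule polyring.ideal_ideal_gen[OF gens_subset])

lemma Var_mult_in_I:
  "1 \<le> i \<Longrightarrow> i \<le> n \<Longrightarrow> i \<le> j \<Longrightarrow> j \<le> lam i \<Longrightarrow> Var i * Var j \<in> I"
  using Var_mult_in_ferrers_gens polyring.ideal_gen_superset by blast

lemma diag_in_I: "diag_poly n lam k \<in> I"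
  unfolding diag_poly_def by (intro polyring.ideal_sum[OF ideal_I] Var_mult_in_I) auto

lemma diag_subset: "diag_poly n lam ` A \<subseteq> R"
  using diag_in_I polyring.ideal_subset[OF ideal_I] by blast

lemma ideal_J: "is_ideal R J"
  by (rule polyring.ideal_ideal_gen[OF diag_subset])

lemma J_subset_I: "J \<subseteq> I"
  using diag_in_I by (intro polyring.ideal_gen_least[OF ideal_I]) blast

text \<open>A position below the main diagonal is reflected. As every row has length at least
  \<open>n\<close>, the reflected position belongs to the tableau whenever both indices are at most
  \<open>n\<close>.\<close>

lemma Var_mult_swap_in_I:
  assumes "1 \<le> i" "i \<le> n" "1 \<le> j" "i \<le> j \<or> j \<le> n" "j \<le> lam i"
  shows "Var i * Var j \<in> I"
proof (cases "i \<le> j")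
  case True
  then show ?thesis using assms by (intro Var_mult_in_I) auto
next
  case False
  then have "i \<le> lam j" using assms lam_bounds[of j] by auto
  then have "Var j * Var i \<in> I" using assms False by (intro Var_mult_in_I) auto
  then show ?thesis by (simp add: mult.commute)
qed

section \<open>The diagonal sums generate a reduction\<close>

text \<open>Multiplying the diagonal sum by its summand \<open>T i\<close> gives the square of
  \<open>T i\<close> plus cross terms. The product is in \<open>J * I\<close>, and the cross terms
  are nilpotent by the swap, which brings in a higher diagonal; so the square is nilpotent.\<close>

lemma gens_nilpotent_mod_J:
  "1 \<le> i \<Longrightarrow> i \<le> n \<Longrightarrow> k + i \<le> lam i \<Longrightarrow> polyring.nilpotent_mod m J I 1 (Var i * Var (k + i))"
proof (induction "m - k" arbitrary: k i rule: less_induct)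
  case less
  note nil = polyring.nilpotent_mod_add[OF ideal_I ideal_J] polyring.nilpotent_mod_uminus[OF ideal_I ideal_J]
  have km: "k < m" using less.prems lam_bounds[of i] by linarith
  define S where "S = {i. 1 \<le> i \<and> i \<le> n \<and> k + i \<le> lam i} - {i}"
  define T :: "nat \<Rightarrow> 'a mpoly" where "T i = Var i * Var (k + i)" for i
  have fin: "finite {i. 1 \<le> i \<and> i \<le> n \<and> k + i \<le> lam i}" by (rule finite_subset[of _ "{..n}"]) auto
  have d: "diag_poly n lam k = T i + (\<Sum>j\<in>S. T j)"
    unfolding diag_poly_def S_def T_def using less.prems by (subst sum.remove[OF fin, of i]) auto
  have TI: "T i \<in> ideal_pow R I 1"
    using less.prems polyring.ideal_pow_1[OF ideal_I] Var_mult_in_I[of i "k + i"] by (simp add: T_def)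
  have prod_nil: "polyring.nilpotent_mod m J I 2 (T p * T q)"
    if pq: "1 \<le> p" "p < q" "q \<le> n" "k + q \<le> lam q" for p q
  proof -
    \<comment> \<open>The diagonal of the swapped monomial \<open>Var p * Var (k + q)\<close>; it
      exceeds \<open>k\<close> because \<open>p < q\<close>.\<close>
    define l where "l = k + (q - p)"
    have l: "l + p = k + q" "m - l < m - k" using pq km by (auto simp: l_def)
    have kq: "k + q \<le> lam p" using pq lam_antimono[of p q] by simp
    have U: "polyring.nilpotent_mod m J I 1 (Var p * Var (l + p) :: 'a mpoly)"
      using l pq kq by (intro less.hyps) auto
    \<comment> \<open>The other swapped factor may fall below the main diagonal, but then both its
      indices are at most \<open>n\<close>.\<close>
    have "q \<le> k + p \<or> k + p \<le> n" using pq by linarith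
    then have Y: "(Var q * Var (k + p) :: 'a mpoly) \<in> ideal_pow R I 1"
      using pq polyring.ideal_pow_1[OF ideal_I Var_mult_swap_in_I[of q "k + p"]] by auto
    have "polyring.nilpotent_mod m J I (1 + 1) ((Var p * Var (l + p)) * (Var q * Var (k + p)) :: 'a mpoly)"
      by (rule polyring.nilpotent_mod_mult[OF ideal_I ideal_J U Y]) simp
    moreover have "(Var p * Var (l + p)) * (Var q * Var (k + p)) = T p * T q"
      unfolding T_def l(1) by (simp add: mult_ac)
    ultimately show ?thesis by (simp only: one_add_one)
  qed
  have cross: "polyring.nilpotent_mod m J I 2 (\<Sum>j\<in>S. T i * T j)"
  proof (rule polyring.nilpotent_mod_sum[OF ideal_I ideal_J])
    fix j assume "j \<in> S"
    then have j: "1 \<le> j" "j \<le> n" "k + j \<le> lam j" "j \<noteq> i" by (auto simp: S_def)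
    show "polyring.nilpotent_mod m J I 2 (T i * T j)"
    proof (cases "i < j")
      case True
      then show ?thesis using j less.prems by (intro prod_nil) auto
    next
      case False
      then have "polyring.nilpotent_mod m J I 2 (T j * T i)" using j less.prems by (intro prod_nil) auto
      then show ?thesis by (simp add: mult.commute)
    qed
  qed simp
  have "diag_poly n lam k \<in> (J :: 'a mpoly set)"
    by (rule subsetD[OF polyring.ideal_gen_superset]) (use km in auto)
  then have "diag_poly n lam k * T i \<in> ideal_prod R J (ideal_pow R I 1)"
    using TI by (rule polyring.ideal_prod_memI)
  moreover have "diag_poly n lam k * T i \<in> ideal_pow R I (1 + 1)"
    using polyring.ideal_pow_1[OF ideal_I diag_in_I[of k]] TI
    by (intro polyring.ideal_pow_add_mult[OF ideal_I]) auto
  ultimately have "polyring.nilpotent_mod m J I 2 (diag_poly n lam k * T i)"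
    by (intro polyring.nilpotent_mod_of_J[OF ideal_I ideal_J]) (simp_all add: numeral_2_eq_2)
  then have "polyring.nilpotent_mod m J I 2 (diag_poly n lam k * T i + - (\<Sum>j\<in>S. T i * T j))"
    using cross by (intro nil) auto
  moreover have "diag_poly n lam k * T i + - (\<Sum>j\<in>S. T i * T j) = T i * T i"
    unfolding d sum_distrib_left[symmetric] by (simp add: algebra_simps)
  ultimately have "polyring.nilpotent_mod m J I (2 * 1) (T i * T i)" by simp
  from polyring.nilpotent_mod_square[OF ideal_I ideal_J TI this] show ?case by (simp add: T_def)
qed

lemma J_reduction: "is_reduction R J I"
proof (rule polyring.reduction_if_nilpotent_mod[OF finite_gens gens_subset ideal_J J_subset_I])
  fix g :: "'a mpoly" assume "g \<in> ferrers_gens n lam"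
  then obtain i j where "g = Var i * Var j" "1 \<le> i" "i \<le> n" "i - 1 < j" "j \<le> lam i"
    unfolding ferrers_gens_def by blast
  then show "polyring.nilpotent_mod m J I 1 g" using gens_nilpotent_mod_J[of i "j - i"] by auto
qed

text \<open>The monomial with exponent \<open>s\<close> is the unit \<open>x\<^sub>j\<close> (or 1) at \<open>P\<close>, so that at \<open>P\<close> the ideal \<open>I\<close> becomes
  \<open>(x\<^sub>1,\<dots>,x\<^sub>c)\<close> plus a specialized Ferrers ideal in \<open>x\<^sub>c\<^sub>+\<^sub>1,\<dots>,x\<^sub>D\<close>.\<close>

lemma local_shape:
  fixes P :: "'a::field mpoly set"
  assumes P: "polyring.prime_in m P" and x: "\<And>i. 1 \<le> i \<Longrightarrow> i \<le> n \<Longrightarrow> Var i \<in> P"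
  obtains c D s where "c \<le> n" "c \<le> D" "\<And>i. i \<in> {1..D} \<Longrightarrow> Var i \<in> P"
    "headfree D s" "Poly_Mapping.single s 1 \<in> (R :: 'a mpoly set)" "Poly_Mapping.single s 1 \<notin> P"
    "\<And>i. 1 \<le> i \<Longrightarrow> i \<le> c \<Longrightarrow> Var i * Poly_Mapping.single s 1 \<in> (I :: 'a mpoly set)"
    "\<And>i. c < i \<Longrightarrow> i \<le> n \<Longrightarrow> lam i \<le> D"
    "c < D \<Longrightarrow> c < n \<and> D = lam (Suc c)"
proof (cases "\<exists>j. n < j \<and> j \<le> m \<and> Var j \<notin> P")
  \<comment> \<open>All variables of the ring lie in \<open>P\<close>: the local picture is the
    original ideal, with no rows split off and the unit 1 in place of a variable.\<close>
  case False
  have one: "Poly_Mapping.single 0 1 = (1 :: 'a mpoly)" by simp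
  show ?thesis
  proof (rule that[of 0 m 0])
    show "Var i \<in> P" if "i \<in> {1..m}" for i using that False x by (cases "i \<le> n") auto
    show "Poly_Mapping.single 0 1 \<notin> P" unfolding one using P by (simp add: polyring.prime_in_def)
  qed (use n lam_bounds lam_1 in \<open>auto simp: headfree_def\<close>)
next
  case True
  define j where "j = (LEAST j. n < j \<and> j \<le> m \<and> Var j \<notin> P)"
  have j: "n < j" "j \<le> m" "Var j \<notin> P" using LeastI_ex[OF True] unfolding j_def by blast+
  have j_least: "Var i \<in> P" if "1 \<le> i" "i < j" for i
  proof (cases "i \<le> n")
    case False
    then show ?thesis using that j(2) not_less_Least[of i "\<lambda>j. n < j \<and> j \<le> m \<and> Var j \<notin> P", folded j_def] by auto
  qed (use x that in auto)
  \<comment> \<open>The alternative \<open>i = 0\<close> keeps the set nonempty when no row reaches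
    column \<open>j\<close>; nothing is assumed about \<open>lam 0\<close>.\<close>
  define c where "c = Max {i. i \<le> n \<and> (i = 0 \<or> j \<le> lam i)}"
  have finC: "finite {i. i \<le> n \<and> (i = 0 \<or> j \<le> lam i)}" by (rule finite_subset[of _ "{..n}"]) auto
  have "c \<in> {i. i \<le> n \<and> (i = 0 \<or> j \<le> lam i)}" unfolding c_def by (rule Max_in[OF finC]) auto
  then have c: "c \<le> n" "c = 0 \<or> j \<le> lam c" by auto
  have c_max: "lam i < j" if "c < i" "i \<le> n" for i
  proof (rule ccontr)
    assume "\<not> ?thesis"
    then have "i \<le> c" unfolding c_def using that by (intro Max_ge[OF finC]) auto
    then show False using that by simp
  qed
  define D where "D = (if c < n then lam (Suc c) else n)"
  have Dj: "D < j" using c_max[of "Suc c"] j by (auto simp: D_def)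
  show ?thesis
  proof (rule that[of c D "Poly_Mapping.single j 1"])
    have V: "Poly_Mapping.single (Poly_Mapping.single j 1) 1 = (Var j :: 'a mpoly)" by (simp add: Var_def)
    show "c \<le> n" by (rule c(1))
    show "c \<le> D" using c lam_bounds[of "Suc c"] by (auto simp: D_def)
    show "Var i \<in> P" if "i \<in> {1..D}" for i using that Dj by (intro j_least) auto
    show "headfree D (Poly_Mapping.single j 1)" using Dj by (auto simp: headfree_def lookup_single when_def)
    show "Poly_Mapping.single (Poly_Mapping.single j 1) 1 \<in> (R :: 'a mpoly set)"
      unfolding V using j by (intro Var_in_polyring) auto
    show "Poly_Mapping.single (Poly_Mapping.single j 1) 1 \<notin> P" unfolding V by (rule j(3))
    show "Var i * Poly_Mapping.single (Poly_Mapping.single j 1) 1 \<in> (I :: 'a mpoly set)" if "1 \<le> i" "i \<le> c" for i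
      unfolding V using that c j lam_antimono[of i c] by (intro Var_mult_in_I) auto
    show "lam i \<le> D" if "c < i" "i \<le> n" for i using that lam_antimono[of "Suc c" i] by (auto simp: D_def)
    show "c < n \<and> D = lam (Suc c)" if "c < D" using that c(1) by (auto simp: D_def split: if_splits)
  qed
qed

section \<open>Minimality of the diagonal reduction\<close>

text \<open>At a suitable prime, a reduction properly inside \<open>J\<close> has fewer than
  \<open>D\<close> generators modulo \<open>P * I\<close>. This forces a relation among the
  monomials in the \<open>D\<close> elements \<open>a i\<close>, which the weight argument
  excludes.\<close>

lemma J_minimal:
  fixes J' :: "'a::field mpoly set"
  assumes J': "J' \<subset> J" and red: "is_reduction R J' I"
  shows False
proof -
  let ?R = "R :: 'a mpoly set" and ?I = "I :: 'a mpoly set" and ?J = "J :: 'a mpoly set"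
  have iJ': "is_ideal ?R J'" using red by (simp add: is_reduction_def)
  have J'J: "J' \<subseteq> ?J" using J' by blast
  have J'I: "J' \<subseteq> ?I" using J'J J_subset_I by blast
  have JR: "?J \<subseteq> ?R" using polyring.ideal_subset[OF ideal_J] by blast
  have IR: "?I \<subseteq> ?R" using polyring.ideal_subset[OF ideal_I] by blast
  obtain r where r: "ideal_pow ?R ?I (Suc r) = ideal_prod ?R J' (ideal_pow ?R ?I r)"
    using red unfolding is_reduction_def by blast
  \<comment> \<open>The colon ideal of \<open>J'\<close> by \<open>J\<close>. It is proper since
    \<open>J'\<close> differs from \<open>J\<close>; at a prime containing it the two ideals still
    differ.\<close>
  define A where "A = {u \<in> ?R. \<forall>h\<in>?J. u * h \<in> J'}"
  have iA: "is_ideal ?R A"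
  proof (rule polyring.is_idealI)
    show "0 \<in> A" unfolding A_def using polyring.ideal_zero[OF iJ'] by simp
  qed (auto simp: A_def distrib_right mult.assoc intro: polyring.ideal_add[OF iJ'] polyring.ideal_mult_left[OF iJ'])
  have "1 \<notin> A" using J' by (auto simp: A_def)
  then obtain P where P: "polyring.prime_in m P" and AP: "A \<subseteq> P"
    using polyring.exists_prime_in[OF iA] by blast
  have Pi: "is_ideal ?R P" using P by (simp add: polyring.prime_in_def)
  have J'P: "J' \<subseteq> P"
  proof -
    have "J' \<subseteq> A" unfolding A_def using iJ' JR polyring.ideal_subset[OF iJ'] polyring.ideal_mult_right[OF iJ'] by auto
    then show ?thesis using AP by blast
  qed
  have xP: "Var i \<in> P" if i: "1 \<le> i" "i \<le> n" for i
  proof -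
    have V: "Var i \<in> ?R" using i lam_bounds[of i] by (intro Var_in_polyring) auto
    have "Var i * Var i \<in> ?I" using i lam_bounds[of i] by (intro Var_mult_in_I) auto
    \<comment> \<open>The square of \<open>Var i\<close> is a generator on the main diagonal; its
      power lies in \<open>I^(r+1) = J' * I^r\<close>, hence in \<open>J'\<close> and in
      \<open>P\<close>.\<close>
    then have "(Var i * Var i) ^ Suc r \<in> ideal_pow ?R ?I (1 * Suc r)"
      using polyring.ideal_pow_1[OF ideal_I] by (intro polyring.ideal_pow_power[OF ideal_I]) simp
    then have "(Var i * Var i) ^ Suc r \<in> ideal_prod ?R J' (ideal_pow ?R ?I r)" by (simp only: r mult_1)
    moreover have "ideal_prod ?R J' (ideal_pow ?R ?I r) \<subseteq> J'"
      using polyring.ideal_subset[OF polyring.ideal_ideal_pow[OF IR]]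
      by (intro polyring.ideal_prod_least[OF iJ'] polyring.ideal_mult_right[OF iJ']) auto
    ultimately have "(Var i * Var i) ^ Suc r \<in> P" using J'P by blast
    then have "Var i * Var i \<in> P" using polyring.prime_in_power[OF P] V by blast
    then show ?thesis using P V unfolding polyring.prime_in_def by blast
  qed
  obtain c D s where cn: "c \<le> n" and cD: "c \<le> D"
    and DP: "\<And>i. i \<in> {1..D} \<Longrightarrow> Var i \<in> P"
    and hs: "headfree D s" and yR: "Poly_Mapping.single s 1 \<in> ?R" and yP: "Poly_Mapping.single s 1 \<notin> P"
    and yI: "\<And>i. 1 \<le> i \<Longrightarrow> i \<le> c \<Longrightarrow> Var i * Poly_Mapping.single s 1 \<in> ?I"
    and lamD: "\<And>i. c < i \<Longrightarrow> i \<le> n \<Longrightarrow> lam i \<le> D"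
    and cDn: "c < D \<Longrightarrow> c < n \<and> D = lam (Suc c)"
    using local_shape[OF P xP] by metis
  define y where "y = (Poly_Mapping.single s 1 :: 'a mpoly)"
  define e where "e k = (\<Sum>i\<in>{i. c < i \<and> i \<le> n \<and> k + i \<le> lam i}. Var i * Var (k + i) :: 'a mpoly)" for k
  \<comment> \<open>Local generators of \<open>J\<close>, at most \<open>c + (D - c) = D\<close> in
    number; \<open>e k\<close> is the part of diagonal \<open>k\<close> below row
    \<open>c\<close>.\<close>
  define G where "G = (\<lambda>i. Var i * y) ` {1..c} \<union> e ` {..<D - c}"
  have finG: "finite G" by (simp add: G_def)
  have eI: "e k \<in> ?I" for k
    unfolding e_def by (intro polyring.ideal_sum[OF ideal_I] Var_mult_in_I) auto
  have GI: "G \<subseteq> ?I" using yI eI by (auto simp: G_def y_def)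
  have GR: "G \<subseteq> ?R" using GI IR by blast
  have iG: "is_ideal ?R (ideal_gen ?R G)" by (rule polyring.ideal_ideal_gen[OF GR])
  have "card G \<le> card ((\<lambda>i. Var i * y) ` {1..c}) + card (e ` {..<D - c})" unfolding G_def by (rule card_Un_le)
  also have "\<dots> \<le> card {1..c} + card {..<D - c}" by (intro add_mono card_image_le) auto
  finally have cardG: "card G \<le> D" using cD by simp
  have diag_y: "diag_poly n lam k * y \<in> ideal_gen ?R G" for k
  proof -
    have fin: "finite {i. c < i \<and> i \<le> n \<and> k + i \<le> lam i}" "finite {i. 1 \<le> i \<and> i \<le> c \<and> k + i \<le> lam i}"
      by (rule finite_subset[of _ "{..n}"], use cn in auto)+
    have "{i. 1 \<le> i \<and> i \<le> n \<and> k + i \<le> lam i} =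
      {i. 1 \<le> i \<and> i \<le> c \<and> k + i \<le> lam i} \<union> {i. c < i \<and> i \<le> n \<and> k + i \<le> lam i}" using cn by auto
    then have "diag_poly n lam k = (\<Sum>i\<in>{i. 1 \<le> i \<and> i \<le> c \<and> k + i \<le> lam i}. Var i * Var (k + i)) + e k"
      unfolding diag_poly_def e_def using fin by (simp add: sum.union_disjoint disjoint_iff)
    then have "diag_poly n lam k * y =
        (\<Sum>i\<in>{i. 1 \<le> i \<and> i \<le> c \<and> k + i \<le> lam i}. Var (k + i) * (Var i * y)) + y * e k"
      by (simp only: distrib_right sum_distrib_right) (simp add: mult_ac)
    moreover have "(\<Sum>i\<in>{i. 1 \<le> i \<and> i \<le> c \<and> k + i \<le> lam i}. Var (k + i) * (Var i * y)) \<in> ideal_gen ?R G"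
    proof (rule polyring.ideal_sum[OF iG])
      fix i assume i: "i \<in> {i. 1 \<le> i \<and> i \<le> c \<and> k + i \<le> lam i}"
      then have "Var (k + i) \<in> ?R" using lam_bounds[of i] cn by (intro Var_in_polyring) auto
      moreover have "Var i * y \<in> ideal_gen ?R G"
        using i by (intro subsetD[OF polyring.ideal_gen_superset]) (auto simp: G_def)
      ultimately show "Var (k + i) * (Var i * y) \<in> ideal_gen ?R G" by (rule polyring.ideal_mult_left[OF iG])
    qed
    moreover have "y * e k \<in> ideal_gen ?R G"
    proof (cases "k < D - c")
      case True
      then have "e k \<in> ideal_gen ?R G" by (intro subsetD[OF polyring.ideal_gen_superset]) (auto simp: G_def)
      then show ?thesis using yR polyring.ideal_mult_left[OF iG] unfolding y_def by blast
    next
      case False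
      \<comment> \<open>Rows below row \<open>c\<close> end at column \<open>D\<close>, whereas
        \<open>i > c\<close> and \<open>k\<close> at least \<open>D - c\<close> give
        \<open>k + i > D\<close>.\<close>
      have "{i. c < i \<and> i \<le> n \<and> k + i \<le> lam i} = {}" using False lamD by fastforce
      then have "e k = 0" unfolding e_def by (simp only: sum.empty)
      then show ?thesis using polyring.ideal_zero[OF iG] by simp
    qed
    ultimately show ?thesis using polyring.ideal_add[OF iG] by simp
  qed
  have yR': "y \<in> ?R" "y \<notin> P" using yR yP by (auto simp: y_def)
  have "diag_poly n lam ` {0..<m} \<subseteq> {h \<in> ?R. h * y \<in> ideal_gen ?R G}"
    using diag_y diag_subset by blast
  then have Jy: "?J \<subseteq> {h \<in> ?R. h * y \<in> ideal_gen ?R G}"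
    by (rule polyring.ideal_gen_least[OF polyring.ideal_colon[OF iG yR'(1)]])
  have gen: "\<exists>t\<in>ideal_gen ?R {}. \<exists>c. (\<forall>g\<in>G. c g \<in> ?R) \<and> y * h = t + (\<Sum>g\<in>G. c g * g)" if h: "h \<in> ?J" for h
  proof -
    have "y * h \<in> ideal_gen ?R ((\<lambda>g. g) ` G)" using Jy h by (auto simp: mult.commute)
    then obtain d where "\<And>g. g \<in> G \<Longrightarrow> d g \<in> ?R" "y * h = (\<Sum>g\<in>G. d g * g)"
      using polyring.ideal_gen_image_obtain[of "y * h" m "\<lambda>g. g" G] finG GR by auto
    then show ?thesis using polyring.ideal_zero[OF polyring.ideal_ideal_gen, of "{}" m]
      by (intro bexI[of _ 0] exI[of _ d]) auto
  qed
  have no: "\<exists>h\<in>?J. u * h \<notin> J'" if "u \<in> ?R" "u \<notin> P" for u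
    using that AP unfolding A_def by blast
  obtain u X where u: "u \<in> ?R" "u \<notin> P" and X: "finite X" "X \<subseteq> J'" "card X < card ({} :: 'a mpoly set) + card G"
    \<comment> \<open>The exchange starts from the empty set of elements of \<open>J'\<close> and
      all of \<open>G\<close>, so \<open>X\<close> has fewer than \<open>D\<close> elements.\<close>
    and dec: "\<forall>h\<in>J'. \<exists>t\<in>ideal_gen ?R X. \<exists>p\<in>ideal_prod ?R P ?I. u * h = t + p"
    using polyring.exchange_generators[OF P iJ' JR J'J no finG GI IR _ _ yR' gen] by auto
  define W where "W = prod_mset ` multisets_of_size (ferrers_gens n lam :: 'a mpoly set) r"
  have W: "ideal_pow ?R ?I r = ideal_gen ?R W" "finite W"
    unfolding W_def using polyring.ideal_pow_gen[OF gens_subset] finite_gens by auto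
  have WR: "W \<subseteq> ?R" unfolding W_def
    using gens_subset by (auto simp: multisets_of_size_def intro!: polyring.prod_mset_closed)
  define a where "a = (\<lambda>i. if i \<le> c then Var i * y else Var (Suc c) * Var i)"
  have aI: "a ` {1..D} \<subseteq> ?I"
  proof safe
    fix i assume i: "i \<in> {1..D}"
    show "a i \<in> ?I"
    proof (cases "i \<le> c")
      case True
      then show ?thesis using yI i by (simp add: a_def y_def)
    next
      case False
      then show ?thesis using i cDn by (auto simp: a_def intro!: Var_mult_in_I)
    qed
  qed
  have wI: "?I \<subseteq> {f \<in> ?R. wt_ge c D 2 f}"
  proof (rule polyring.ideal_gen_least[OF ideal_wt_ge])
    show "ferrers_gens n lam \<subseteq> {f \<in> ?R. wt_ge c D 2 f}"
    proof
      fix g :: "'a mpoly" assume g: "g \<in> ferrers_gens n lam"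
      then obtain i j where ij: "g = Var i * Var j" "1 \<le> i" "i \<le> n" "i - 1 < j" "j \<le> lam i"
        unfolding ferrers_gens_def by blast
      have "wt_ge c D ((if i \<in> {1..D} then if i \<le> c then 2 else 1 else 0)
          + (if j \<in> {1..D} then if j \<le> c then 2 else 1 else 0)) g"
        unfolding ij(1) by (rule wt_ge_mult[OF wt_ge_Var wt_ge_Var])
      \<comment> \<open>Either \<open>Var i\<close> alone has weight 2, or both indices lie between
        \<open>c + 1\<close> and \<open>D\<close> and each variable contributes 1.\<close>
      moreover have "i \<le> c \<or> j \<le> D" using lamD[of i] ij by fastforce
      ultimately have "wt_ge c D 2 g"
        by (rule_tac wt_ge_weaken) (use ij cD in auto)
      then show "g \<in> {f \<in> ?R. wt_ge c D 2 f}" using g gens_subset by blast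
    qed
  qed
  have "\<exists>M z. (\<forall>Z\<in>multisets_of_size {1..D} M. z Z \<in> ?R) \<and> (\<exists>Z\<in>multisets_of_size {1..D} M. z Z \<notin> P) \<and>
    (\<Sum>Z\<in>multisets_of_size {1..D} M. z Z * prod_mset (image_mset a Z)) \<in> ideal_prod ?R P (ideal_pow ?R ?I M)"
  proof (rule polyring.monomials_dependent_mod_prime[OF ideal_I P iJ' _ W(1) WR W(2) X(2) J'I X(1) u _ _ _ aI])
    show "ideal_pow ?R ?I (Suc r) \<subseteq> ideal_prod ?R J' (ideal_pow ?R ?I r)" by (simp only: r)
    show "card X < card {1..D}" using X(3) cardG by simp
  qed (use dec in auto)
  then obtain M z Z where z: "\<forall>Z\<in>multisets_of_size {1..D} M. z Z \<in> ?R"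
    "(\<Sum>Z\<in>multisets_of_size {1..D} M. z Z * prod_mset (image_mset a Z)) \<in> ideal_prod ?R P (ideal_pow ?R ?I M)"
    and Z: "Z \<in> multisets_of_size {1..D} M" "z Z \<notin> P" by blast
  have "z Z \<in> P"
    using monomials_independent_mod_prime[OF P DP wI hs yR yP _ z(2)[unfolded a_def y_def] Z(1)] z(1) by blast
  then show False using Z(2) by simp
qed

end

theorem theorem5p2:
  fixes n m :: nat and lam :: "nat \<Rightarrow> nat"
  assumes "1 \<le> n"
    and "\<And>i j. 1 \<le> i \<Longrightarrow> i \<le> j \<Longrightarrow> j \<le> n \<Longrightarrow> lam j \<le> lam i"
    and "lam 1 = m"
    and "lam n \<ge> n"
  shows "is_minimal_reduction (polyring m :: 'a::field mpoly set)
           (ideal_gen (polyring m) (diag_poly n lam ` {0..<m}))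
           (ideal_gen (polyring m) (ferrers_gens n lam))"
proof -
  interpret ferrers n m lam
    using assms by unfold_locales
  show ?thesis
    unfolding is_minimal_reduction_def using J_reduction J_minimal by blast
qed

end
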